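(* Let $d$ and $m$ be coprime positive integers with $d<m$. Then there is an isomorphism of varieties $$M_{d,m}\simeq M_{m-d,m}.$$
   Context: For positive integers $d,m$, an $m$-tuple $(p_1,\ldots,p_m)\in(\mathbb{P}^{d-1})^m$ of points of complex projective space is semistable if for every non-empty proper subset $I\subset\{1,\ldots,m\}$ the projective linear subspace $U_I$ spanned by the $p_i$, $i\in I$, satisfies $\dim U_I\ge\frac{d}{m}|I|-1$. $M_{d,m}=(\mathbb{P}^{d-1})^m_{\mathrm{sst}}//\mathrm{PGL}_d$ is the GIT quotient of the semistable locus by the diagonal action of $\mathrm{PGL}_d$, parametrizing closed orbits in the semistable locus (linearization: a power of $\mathcal{O}(1,\ldots,1)$). *)

theory Defs
  imports "HOL-Analysis.Function_Topology" "Jordan_Normal_Form.DL_Rank"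
begin

section \<open>Spaces with functions\<close>

text \<open>
  Complex varieties are treated classically, as topological spaces with a sheaf of complex-valued
  functions (the closed points with the Zariski topology and the regular functions). For open
  \<open>U\<close>, the set \<open>regular X U\<close> consists of the total functions whose restriction to \<open>U\<close> is a
  section over \<open>U\<close>; values outside \<open>U\<close> are irrelevant, and \<open>regular X U\<close> has no meaning for
  \<open>U\<close> not open. A morphism of varieties is a continuous map that pulls regular functions back to
  regular functions.
\<close>

record 'a fspace =
  top_of :: "'a topology"
  regular :: "'a set \<Rightarrow> ('a \<Rightarrow> complex) set"

abbreviation points :: "'a fspace \<Rightarrow> 'a set" where
  "points X \<equiv> topspace (top_of X)"

definition morphism :: "'a fspace \<Rightarrow> 'b fspace \<Rightarrow> ('a \<Rightarrow> 'b) \<Rightarrow> bool" where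
  "morphism X Y \<phi> \<longleftrightarrow>
     continuous_map (top_of X) (top_of Y) \<phi> \<and>
     (\<forall>V f. openin (top_of Y) V \<longrightarrow> f \<in> regular Y V \<longrightarrow>
        f \<circ> \<phi> \<in> regular X {x \<in> points X. \<phi> x \<in> V})"

definition isomorphic :: "'a fspace \<Rightarrow> 'b fspace \<Rightarrow> bool" where
  "isomorphic X Y \<longleftrightarrow>
     (\<exists>\<phi> \<psi>. morphism X Y \<phi> \<and> morphism Y X \<psi> \<and>
        (\<forall>x \<in> points X. \<psi> (\<phi> x) = x) \<and> (\<forall>y \<in> points Y. \<phi> (\<psi> y) = y))"

definition open_subspace :: "'a fspace \<Rightarrow> 'a set \<Rightarrow> 'a fspace" where
  "open_subspace X S = \<lparr>top_of = subtopology (top_of X) S, regular = regular X\<rparr>"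


section \<open>GIT quotients\<close>

text \<open>
  \<open>\<Gamma>\<close> is a group of transformations of the semistable locus \<open>X\<close>. The GIT quotient \<open>X // \<Gamma>\<close> is the
  good quotient: its points are the closed orbits, the quotient map sends a point to the unique
  closed orbit in the closure of its orbit, a set is open iff its preimage is, and the sections
  over \<open>U\<close> are the functions on \<open>U\<close> whose pullback is regular on the preimage of \<open>U\<close>, i.e.
  the structure sheaf is the sheaf of invariants of the direct image of the one of \<open>X\<close>.
\<close>

definition orbit :: "('a \<Rightarrow> 'a) set \<Rightarrow> 'a \<Rightarrow> 'a set" where
  "orbit \<Gamma> x = {\<gamma> x | \<gamma>. \<gamma> \<in> \<Gamma>}"

definition closed_orbits :: "'a fspace \<Rightarrow> ('a \<Rightarrow> 'a) set \<Rightarrow> 'a set set" where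
  "closed_orbits X \<Gamma> = {orbit \<Gamma> x | x. x \<in> points X \<and> closedin (top_of X) (orbit \<Gamma> x)}"

definition quotient_proj :: "'a fspace \<Rightarrow> ('a \<Rightarrow> 'a) set \<Rightarrow> 'a \<Rightarrow> 'a set" where
  "quotient_proj X \<Gamma> x =
     (THE Z. Z \<in> closed_orbits X \<Gamma> \<and> Z \<subseteq> top_of X closure_of (orbit \<Gamma> x))"

definition quotient_preimage :: "'a fspace \<Rightarrow> ('a \<Rightarrow> 'a) set \<Rightarrow> 'a set set \<Rightarrow> 'a set" where
  "quotient_preimage X \<Gamma> U = {x \<in> points X. quotient_proj X \<Gamma> x \<in> U}"

definition GIT_quotient :: "'a fspace \<Rightarrow> ('a \<Rightarrow> 'a) set \<Rightarrow> 'a set fspace" (infixl "'/'/" 70) where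
  "X // \<Gamma> =
     \<lparr>top_of = topology (\<lambda>U. U \<subseteq> closed_orbits X \<Gamma> \<and> openin (top_of X) (quotient_preimage X \<Gamma> U)),
      regular = (\<lambda>U. {f. f \<circ> quotient_proj X \<Gamma> \<in> regular X (quotient_preimage X \<Gamma> U)})\<rparr>"

lemma openin_GIT_quotient:
  "openin (top_of (X // \<Gamma>)) U \<longleftrightarrow>
     U \<subseteq> closed_orbits X \<Gamma> \<and> openin (top_of X) (quotient_preimage X \<Gamma> U)"
proof -
  have inter: "quotient_preimage X \<Gamma> (S \<inter> T) = quotient_preimage X \<Gamma> S \<inter> quotient_preimage X \<Gamma> T"
    for S T by (auto simp: quotient_preimage_def)
  have union: "quotient_preimage X \<Gamma> (\<Union>K) = \<Union>(quotient_preimage X \<Gamma> ` K)" for K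
    by (auto simp: quotient_preimage_def)
  have "istopology (\<lambda>U. U \<subseteq> closed_orbits X \<Gamma> \<and> openin (top_of X) (quotient_preimage X \<Gamma> U))"
    unfolding istopology_def inter union by auto
  then show ?thesis
    by (simp add: GIT_quotient_def topology_inverse')
qed


section \<open>Products of projective spaces\<close>

text \<open>Points of \<open>\<bbbP>\<^sup>d\<^sup>-\<^sup>1\<close> are the lines through the origin of \<open>\<complex>\<^sup>d\<close>.\<close>

definition proj_space :: "nat \<Rightarrow> complex vec set set" where
  "proj_space d = {{c \<cdot>\<^sub>v v | c. True} | v. v \<in> carrier_vec d \<and> v \<noteq> 0\<^sub>v d}"

type_synonym point_tuple = "nat \<Rightarrow> complex vec set"

definition proj_tuples :: "nat \<Rightarrow> nat \<Rightarrow> point_tuple set" where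
  "proj_tuples d m = {..<m} \<rightarrow>\<^sub>E proj_space d"

definition reps :: "nat \<Rightarrow> nat \<Rightarrow> point_tuple \<Rightarrow> (nat \<Rightarrow> complex vec) set" where
  "reps d m p = {v. \<forall>i<m. v i \<in> p i - {0\<^sub>v d}}"

text \<open>
  \<open>multihom d m k F\<close>: \<open>F\<close> is a polynomial in the coordinates of \<open>m\<close> vectors of \<open>\<complex>\<^sup>d\<close>,
  homogeneous of degree \<open>k i\<close> in the coordinates of the \<open>i\<close>-th vector. In the monomial with
  exponent \<open>e\<close>, the number \<open>e i j\<close> is the power of the \<open>j\<close>-th coordinate of the \<open>i\<close>-th vector.
\<close>

definition multihom :: "nat \<Rightarrow> nat \<Rightarrow> (nat \<Rightarrow> nat) \<Rightarrow> ((nat \<Rightarrow> complex vec) \<Rightarrow> complex) \<Rightarrow> bool" where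
  "multihom d m k F \<longleftrightarrow>
     (\<exists>(E :: (nat \<Rightarrow> nat \<Rightarrow> nat) set) a. finite E \<and> (\<forall>e\<in>E. \<forall>i<m. (\<Sum>j<d. e i j) = k i) \<and>
        F = (\<lambda>v. \<Sum>e\<in>E. a e * (\<Prod>i<m. \<Prod>j<d. vec_index (v i) j ^ e i j)))"

text \<open>The Zariski topology, generated by the non-vanishing loci of multihomogeneous polynomials\<close>

definition zariski :: "nat \<Rightarrow> nat \<Rightarrow> point_tuple topology" where
  "zariski d m = topology_generated_by
     {{p \<in> proj_tuples d m. \<forall>v \<in> reps d m p. F v \<noteq> 0} | F. \<exists>k. multihom d m k F}"

text \<open>Regular functions: locally, quotients of multihomogeneous polynomials of equal multidegree\<close>

definition regular_on ::
  "nat \<Rightarrow> nat \<Rightarrow> point_tuple set \<Rightarrow> (point_tuple \<Rightarrow> complex) set" where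
  "regular_on d m U =
     {f. \<forall>p\<in>U. \<exists>V k F G. openin (zariski d m) V \<and> p \<in> V \<and>
           multihom d m k F \<and> multihom d m k G \<and>
           (\<forall>q \<in> U \<inter> V. \<forall>v \<in> reps d m q. G v \<noteq> 0 \<and> f q = F v / G v)}"

definition proj_power :: "nat \<Rightarrow> nat \<Rightarrow> point_tuple fspace" where
  "proj_power d m = \<lparr>top_of = zariski d m, regular = regular_on d m\<rparr>"


section \<open>The moduli spaces of point configurations\<close>

text \<open>\<open>PGL\<^sub>d\<close> as the group of projective transformations of \<open>\<bbbP>\<^sup>d\<^sup>-\<^sup>1\<close>; the restriction makes
  proportional matrices give the same transformation.\<close>

definition PGL :: "nat \<Rightarrow> (complex vec set \<Rightarrow> complex vec set) set" where
  "PGL d = {restrict (\<lambda>L. (\<lambda>v. g *\<^sub>v v) ` L) (proj_space d) | g.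
              g \<in> carrier_mat d d \<and> invertible_mat g}"

definition diagonal_PGL :: "nat \<Rightarrow> nat \<Rightarrow> (point_tuple \<Rightarrow> point_tuple) set" where
  "diagonal_PGL d m = {\<lambda>p. \<lambda>i\<in>{..<m}. \<gamma> (p i) | \<gamma>. \<gamma> \<in> PGL d}"

definition (in vec_space) span_dim :: "'a vec set \<Rightarrow> nat" where
  "span_dim S = vectorspace.dim class_ring (span_vs S)"

text \<open>The dimension of the projective linear subspace spanned by the given points: one less than
  that of the linear span of the corresponding lines\<close>

definition proj_span_dim :: "nat \<Rightarrow> complex vec set set \<Rightarrow> int" where
  "proj_span_dim d Q = int (vec_space.span_dim d (\<Union>Q)) - 1"

text \<open>The numerical form of semistability for the linearization by a power of \<open>\<O>(1,\<dots>,1)\<close>\<close>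

definition semistable :: "nat \<Rightarrow> nat \<Rightarrow> point_tuple \<Rightarrow> bool" where
  "semistable d m p \<longleftrightarrow>
     (\<forall>I. I \<noteq> {} \<and> I \<subset> {..<m} \<longrightarrow>
        real_of_int (proj_span_dim d (p ` I)) \<ge> real d / real m * real (card I) - 1)"

definition semistable_locus :: "nat \<Rightarrow> nat \<Rightarrow> point_tuple fspace" where
  "semistable_locus d m =
     open_subspace (proj_power d m) {p \<in> proj_tuples d m. semistable d m p}"

definition moduli_space :: "nat \<Rightarrow> nat \<Rightarrow> point_tuple set fspace" where
  "moduli_space d m = semistable_locus d m // diagonal_PGL d m"

end

theory Submission
  imports Defs
begin

text \<open>
  The isomorphism is the Gale transform. Write a tuple of points of \<open>\<bbbP>\<^sup>d\<^sup>-\<^sup>1\<close> as the columns of a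
  \<open>d \<times> m\<close> matrix \<open>A\<close>, and let the rows of the \<open>n \<times> m\<close> matrix \<open>B\<close>, \<open>n = m - d\<close>, be a basis of the linear
  relations among these columns. Then \<open>A B\<^sup>T = 0\<close> is symmetric in \<open>A\<close> and \<open>B\<close>. Complements of column
  bases of \<open>A\<close> are column bases of \<open>B\<close>, so semistability passes from \<open>A\<close> to \<open>B\<close>. Relating \<open>p\<close> and \<open>q\<close>
  if \<open>A B\<^sup>T = 0\<close> for suitable representatives matches the \<open>PGL\<^sub>d\<close>-orbits with the \<open>PGL\<^sub>n\<close>-orbits.

  If \<open>\<lambda>\<close> is a nonzero diagonal matrix with support \<open>S\<close> and \<open>A \<lambda> B\<^sup>T = 0\<close>, then the columns in \<open>S\<close> satisfy
  \<open>rk A\<^sub>S + rk B\<^sub>S \<le> |S|\<close>. Semistability and coprimality exclude this for a proper subset \<open>S\<close>, so \<open>\<lambda>\<close> is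
  invertible. Hence the orbit related to \<open>q\<close> is cut out by the existence of a nonzero solution of a
  linear system with polynomial coefficients, so it is closed.

  Where the determinant of \<open>d\<close> chosen columns of \<open>A\<close> does not vanish, \<open>B\<close> can be chosen polynomial in \<open>A\<close>.
  Its entries are not multihomogeneous, but a function on the projective tuples that is a quotient of
  polynomials is also the quotient of corresponding multihomogeneous components.
\<close>

section \<open>Linear algebra of finite families\<close>

text \<open>Gaussian elimination by induction on the equations: if some unknown \<open>l\<close>
  occurs in the equation \<open>b\<close>, solving for it leaves one equation and one unknown
  fewer.\<close>

lemma underdetermined_system:
  fixes f :: "'i \<Rightarrow> 'b \<Rightarrow> 'a::field"
  assumes "finite A" "finite J" "card A < card J"
  shows "\<exists>c. (\<forall>a\<in>A. (\<Sum>j\<in>J. c j * f j a) = 0) \<and> (\<exists>j\<in>J. c j \<noteq> 0)"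
  using assms
proof (induction A arbitrary: f J rule: finite_induct)
  case empty
  then have "J \<noteq> {}" by auto
  then show ?case by (intro exI[of _ "\<lambda>_. 1"]) auto
next
  case (insert b A)
  show ?case
  proof (cases "\<forall>j\<in>J. f j b = 0")
    case True
    obtain c where "\<forall>a\<in>A. (\<Sum>j\<in>J. c j * f j a) = 0" "\<exists>j\<in>J. c j \<noteq> 0"
      using insert.IH[of J f] insert.prems insert.hyps by auto
    with True show ?thesis by (intro exI[of _ c]) auto
  next
    case False
    then obtain l where l: "l \<in> J" "f l b \<noteq> 0" by auto
    define J' where "J' = J - {l}"
    have J: "J = insert l J'" "l \<notin> J'" "finite J'"
      using l insert.prems by (auto simp: J'_def)
    have "card A < card J'" using insert.prems insert.hyps J by simp
    then obtain c where c: "\<And>a. a\<in>A \<Longrightarrow> (\<Sum>j\<in>J'. c j * (f j a - f j b / f l b * f l a)) = 0"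
        "\<exists>j\<in>J'. c j \<noteq> 0"
      using insert.IH[of J' "\<lambda>j a. f j a - f j b / f l b * f l a"] J by auto
    define s where "s = (\<Sum>j\<in>J'. c j * f j b)"
    have *: "(\<Sum>j\<in>J'. c j * f j a) = s / f l b * f l a" if "a \<in> A" for a
    proof -
      have "0 = (\<Sum>j\<in>J'. c j * f j a) - (\<Sum>j\<in>J'. c j * f j b * (f l a / f l b))"
        using c(1)[OF that] by (simp add: algebra_simps sum_subtractf)
      also have "(\<Sum>j\<in>J'. c j * f j b * (f l a / f l b)) = s * (f l a / f l b)"
        by (simp only: s_def sum_distrib_right)
      finally show ?thesis by simp
    qed
    \<comment> \<open>The pivot unknown gets the value that the equation \<open>b\<close> forces on
      it.\<close>
    define c' where "c' = c(l := - s / f l b)"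
    have "(\<Sum>j\<in>J. c' j * f j a) = - s / f l b * f l a + (\<Sum>j\<in>J'. c j * f j a)" for a
      using J by (auto simp: c'_def intro!: sum.cong)
    then have "\<forall>a\<in>insert b A. (\<Sum>j\<in>J. c' j * f j a) = 0"
      using * l by (auto simp: s_def[symmetric])
    moreover have "\<exists>j\<in>J. c' j \<noteq> 0" using c(2) J by (auto simp: c'_def)
    ultimately show ?thesis by blast
  qed
qed

text \<open>The target is adjoined as an extra column, indexed by \<open>None\<close>. The enlarged
  system is underdetermined, and injectivity makes the coefficient of the extra column nonzero, so
  one can divide by it.\<close>

lemma injective_imp_surjective:
  fixes f :: "'i \<Rightarrow> 'b \<Rightarrow> 'a::field"
  assumes fin: "finite A" "finite J" and card: "card A \<le> card J"
    and inj: "\<And>c. \<forall>a\<in>A. (\<Sum>j\<in>J. c j * f j a) = 0 \<Longrightarrow> \<forall>j\<in>J. c j = 0"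
  shows "\<exists>c. \<forall>a\<in>A. (\<Sum>j\<in>J. c j * f j a) = t a"
proof -
  define g where "g = (\<lambda>x a. case x of None \<Rightarrow> - t a | Some j \<Rightarrow> f j a)"
  have sum: "(\<Sum>x\<in>insert None (Some ` J). c x * g x a) = (\<Sum>j\<in>J. c (Some j) * f j a) - c None * t a" for c a
    using fin by (simp add: sum.reindex g_def)
  have "card A < card (insert None (Some ` J))"
    using fin card by (simp add: card_image)
  then obtain c where c: "\<And>a. a\<in>A \<Longrightarrow> (\<Sum>j\<in>J. c (Some j) * f j a) = c None * t a"
      "\<exists>x\<in>insert None (Some ` J). c x \<noteq> 0"
    using underdetermined_system[of A "insert None (Some ` J)" g] fin unfolding sum by auto
  have "c None \<noteq> 0"
    using inj[of "\<lambda>j. c (Some j)"] c by auto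
  then have "(\<Sum>j\<in>J. c (Some j) / c None * f j a) = t a" if "a \<in> A" for a
    using c(1)[OF that] by (simp add: sum_divide_distrib[symmetric])
  then show ?thesis by (intro exI[of _ "\<lambda>j. c (Some j) / c None"]) simp
qed

section \<open>Independent families and bases\<close>

definition indep :: "nat \<Rightarrow> (nat \<Rightarrow> nat \<Rightarrow> 'a::field) \<Rightarrow> nat set \<Rightarrow> bool" where
  "indep d v J \<longleftrightarrow> (\<forall>c. (\<forall>a<d. (\<Sum>j\<in>J. c j * v j a) = 0) \<longrightarrow> (\<forall>j\<in>J. c j = 0))"

definition basis_of :: "nat \<Rightarrow> (nat \<Rightarrow> nat \<Rightarrow> 'a::field) \<Rightarrow> nat set \<Rightarrow> bool" where
  "basis_of d v J \<longleftrightarrow> finite J \<and> card J = d \<and> indep d v J"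

lemma indepD:
  "indep d v J \<Longrightarrow> (\<And>a. a < d \<Longrightarrow> (\<Sum>j\<in>J. c j * v j a) = 0) \<Longrightarrow> j \<in> J \<Longrightarrow> c j = 0"
  unfolding indep_def by blast

lemma indep_subset:
  assumes "indep d v J" "I \<subseteq> J" "finite J"
  shows "indep d v I"
  unfolding indep_def
proof (intro allI impI)
  fix c assume c: "\<forall>a<d. (\<Sum>j\<in>I. c j * v j a) = 0"
  define c' where "c' = (\<lambda>j. if j \<in> I then c j else 0)"
  have "(\<Sum>j\<in>J. c' j * v j a) = (\<Sum>j\<in>I. c j * v j a)" for a
    using assms by (intro sum.mono_neutral_cong_right) (auto simp: c'_def)
  then have "\<forall>a<d. (\<Sum>j\<in>J. c' j * v j a) = 0" using c by simp
  then have "c' j = 0" if "j \<in> J" for j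
    using indepD[OF assms(1), of c'] that by blast
  then show "\<forall>j\<in>I. c j = 0" using assms(2) by (metis c'_def subsetD)
qed

text \<open>If the bound failed, the coefficient matrix \<open>C\<close> would have more rows than
  columns, and a nontrivial combination of its rows would vanish; the same combination of the
  \<open>v k\<close> would then vanish too.\<close>

lemma indep_card_le_generators:
  assumes "indep d v K" "finite K" "finite J"
    and gen: "\<And>k. k \<in> K \<Longrightarrow> \<exists>c. \<forall>a<d. v k a = (\<Sum>j\<in>J. c j * w j a)"
  shows "card K \<le> card J"
proof (rule ccontr)
  assume "\<not> card K \<le> card J"
  obtain C where C: "\<And>k a. k \<in> K \<Longrightarrow> a < d \<Longrightarrow> v k a = (\<Sum>j\<in>J. C k j * w j a)"
    using gen by metis
  obtain x where x: "\<forall>j\<in>J. (\<Sum>k\<in>K. x k * C k j) = 0" "\<exists>k\<in>K. x k \<noteq> 0"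
    using underdetermined_system[of J K C] assms \<open>\<not> card K \<le> card J\<close> by auto
  have "(\<Sum>k\<in>K. x k * v k a) = 0" if "a < d" for a
  proof -
    have "(\<Sum>k\<in>K. x k * v k a) = (\<Sum>k\<in>K. \<Sum>j\<in>J. x k * C k j * w j a)"
      using C that by (simp add: sum_distrib_left mult.assoc)
    also have "\<dots> = (\<Sum>j\<in>J. (\<Sum>k\<in>K. x k * C k j) * w j a)"
      by (subst sum.swap) (simp add: sum_distrib_right)
    finally show ?thesis using x by simp
  qed
  then show False using indepD[OF assms(1), of x] x(2) by blast
qed

lemma indep_card_le:
  assumes "indep d v J" "finite J"
  shows "card J \<le> d"
proof (rule ccontr)
  assume "\<not> card J \<le> d"
  then obtain c where "\<forall>a\<in>{..<d}. (\<Sum>j\<in>J. c j * v j a) = 0" "\<exists>j\<in>J. c j \<noteq> 0"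
    using underdetermined_system[of "{..<d}" J v] assms(2) by auto
  then show False using indepD[OF assms(1), of c] by blast
qed

lemma indep_insert_or_span:
  assumes "indep d v J" "finite J" "i \<notin> J" "\<not> indep d v (insert i J)"
  shows "\<exists>c. \<forall>a<d. v i a = (\<Sum>j\<in>J. c j * v j a)"
proof -
  obtain c where c: "\<And>a. a < d \<Longrightarrow> c i * v i a + (\<Sum>j\<in>J. c j * v j a) = 0" "\<exists>j\<in>insert i J. c j \<noteq> 0"
    using assms unfolding indep_def[of d v "insert i J"] by auto
  have "c i \<noteq> 0"
  proof
    assume 0: "c i = 0"
    then have "\<forall>a<d. (\<Sum>j\<in>J. c j * v j a) = 0" using c(1) by simp
    then have "c j = 0" if "j \<in> J" for j
      using indepD[OF assms(1), of c] that by blast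
    with 0 c(2) show False by blast
  qed
  then have "v i a = (\<Sum>j\<in>J. (- c j / c i) * v j a)" if "a < d" for a
    using c(1)[OF that] by (simp add: sum_divide_distrib[symmetric] sum_negf field_simps eq_neg_iff_add_eq_0)
  then show ?thesis by (intro exI[of _ "\<lambda>j. - c j / c i"]) simp
qed

text \<open>An independent set of greatest cardinality between \<open>J\<close> and \<open>I\<close>
  works, since an index whose vector lies outside its span could be adjoined.\<close>

lemma ex_maximal_indep:
  assumes "indep d v J" "J \<subseteq> I" "finite I"
  shows "\<exists>J'. J \<subseteq> J' \<and> J' \<subseteq> I \<and> indep d v J' \<and>
    (\<forall>i\<in>I. \<exists>c. \<forall>a<d. v i a = (\<Sum>j\<in>J'. c j * v j a))"
proof -
  define P where "P = (\<lambda>J'. J \<subseteq> J' \<and> J' \<subseteq> I \<and> indep d v J')"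
  have PJ: "P J" using assms by (simp add: P_def)
  have bdd: "\<forall>J'. P J' \<longrightarrow> card J' < Suc (card I)"
    using assms by (auto simp: P_def card_mono le_imp_less_Suc)
  obtain J' where J': "P J'" "\<And>K. P K \<Longrightarrow> card K \<le> card J'"
    using ex_has_greatest_nat[where f = card, OF PJ bdd] by auto
  have fin: "finite J'" using J'(1) assms(3) by (auto simp: P_def intro: finite_subset)
  have "\<exists>c. \<forall>a<d. v i a = (\<Sum>j\<in>J'. c j * v j a)" if "i \<in> I" for i
  proof (cases "i \<in> J'")
    case True
    then show ?thesis using fin
      by (intro exI[of _ "\<lambda>j. if j = i then 1 else 0"]) (auto simp: if_distrib[of "\<lambda>x. x * _"] cong: if_cong)
  next
    case False
    have "\<not> indep d v (insert i J')"
      using J'(2)[of "insert i J'"] J'(1) False fin that by (auto simp: P_def)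
    moreover have "indep d v J'" using J'(1) by (simp add: P_def)
    ultimately show ?thesis by (intro indep_insert_or_span[OF _ fin False])
  qed
  with J'(1) show ?thesis unfolding P_def by (intro exI[of _ J']) simp
qed

lemma extend_to_basis:
  assumes "indep d v J" "J \<subseteq> I" "finite I" "basis_of d v K" "K \<subseteq> I"
  shows "\<exists>J'. J \<subseteq> J' \<and> J' \<subseteq> I \<and> basis_of d v J'"
proof -
  obtain J' where J': "J \<subseteq> J'" "J' \<subseteq> I" "indep d v J'"
      "\<And>i. i\<in>I \<Longrightarrow> \<exists>c. \<forall>a<d. v i a = (\<Sum>j\<in>J'. c j * v j a)"
    using ex_maximal_indep[OF assms(1-3)] by blast
  have fin: "finite J'" by (rule finite_subset[OF J'(2) assms(3)])
  have "card K \<le> card J'"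
    proof (rule indep_card_le_generators[where v = v and w = v])
    show "indep d v K" "finite K" using assms(4) by (simp_all add: basis_of_def)
    show "\<exists>c. \<forall>a<d. v k a = (\<Sum>j\<in>J'. c j * v j a)" if "k \<in> K" for k
      using that assms(5) by (intro J'(4)) auto
  qed (rule fin)
  then have "basis_of d v J'"
    using indep_card_le[OF J'(3) fin] J'(3) fin assms(4) by (auto simp: basis_of_def)
  with J' show ?thesis by blast
qed

lemma basis_span:
  assumes "basis_of d v J"
  shows "\<exists>c. \<forall>a<d. (\<Sum>j\<in>J. c j * v j a) = t a"
proof -
  have "\<exists>c. \<forall>a\<in>{..<d}. (\<Sum>j\<in>J. c j * v j a) = t a"
  proof (rule injective_imp_surjective)
    have "indep d v J" using assms by (simp add: basis_of_def)
    then show "\<forall>j\<in>J. c j = 0" if "\<forall>a\<in>{..<d}. (\<Sum>j\<in>J. c j * v j a) = 0" for c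
      using indepD[of d v J c] that by blast
  qed (use assms in \<open>auto simp: basis_of_def\<close>)
  then show ?thesis by (metis lessThan_iff)
qed

text \<open>The functional \<open>y\<close> vanishes on a spanning family, hence on the unit vector
  that reads off its coordinate \<open>a\<close>.\<close>

lemma basis_annihilator:
  assumes "basis_of d v J" "\<And>j. j \<in> J \<Longrightarrow> (\<Sum>a<d. y a * v j a) = 0" "a < d"
  shows "y a = 0"
proof -
  obtain c where c: "\<And>b. b < d \<Longrightarrow> (\<Sum>j\<in>J. c j * v j b) = (if b = a then 1 else 0)"
    using basis_span[OF assms(1), of "\<lambda>b. if b = a then 1 else 0"] by blast
  have "y a = (\<Sum>b<d. y b * (if b = a then 1 else 0))"
    using assms(3) by (simp add: if_distrib[of "\<lambda>x. _ * x"] cong: if_cong)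
  also have "\<dots> = (\<Sum>b<d. \<Sum>j\<in>J. c j * (y b * v j b))"
    by (intro sum.cong refl, subst c[symmetric]) (simp_all add: sum_distrib_left mult.left_commute)
  also have "\<dots> = (\<Sum>j\<in>J. c j * (\<Sum>b<d. y b * v j b))"
    by (subst sum.swap) (simp add: sum_distrib_left)
  also have "\<dots> = 0" using assms(2) by (intro sum.neutral) auto
  finally show ?thesis .
qed

lemma basis_functional:
  assumes "basis_of d v J"
  shows "\<exists>y. \<forall>j\<in>J. (\<Sum>a<d. y a * v j a) = t j"
proof (rule injective_imp_surjective)
  show "\<forall>a\<in>{..<d}. y a = 0" if "\<forall>j\<in>J. (\<Sum>a<d. y a * v j a) = 0" for y
    using basis_annihilator[OF assms, of y] that by blast
qed (use assms in \<open>auto simp: basis_of_def\<close>)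

text \<open>Functionals are determined by their values on \<open>J\<close>, and since
  \<open>card J = d\<close> all values occur. The functional with value 1 at \<open>i\<close> and 0
  on the rest of \<open>J\<close> isolates the coefficient \<open>c i\<close> in any
  relation.\<close>

lemma basis_if_annihilator:
  assumes "finite J" "card J = d"
    and "\<And>y. (\<And>j. j \<in> J \<Longrightarrow> (\<Sum>a<d. y a * v j a) = 0) \<Longrightarrow> \<forall>a<d. y a = 0"
  shows "basis_of d v J"
proof -
  have surj: "\<exists>y. \<forall>j\<in>J. (\<Sum>a<d. y a * v j a) = t j" for t
  proof (rule injective_imp_surjective)
    show "\<forall>a\<in>{..<d}. y a = 0" if "\<forall>j\<in>J. (\<Sum>a<d. y a * v j a) = 0" for y
      using assms(3)[of y] that by blast
  qed (use assms in auto)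
  have "c i = 0" if c: "\<And>a. a < d \<Longrightarrow> (\<Sum>j\<in>J. c j * v j a) = 0" and i: "i \<in> J" for c i
  proof -
    obtain y where y: "\<And>j. j\<in>J \<Longrightarrow> (\<Sum>a<d. y a * v j a) = (if j = i then 1 else 0)"
      using surj[of "\<lambda>j. if j = i then 1 else 0"] by blast
    have "c i = (\<Sum>j\<in>J. c j * (if j = i then 1 else 0))"
      using i assms(1) by (simp add: if_distrib[of "\<lambda>x. _ * x"] cong: if_cong)
    also have "\<dots> = (\<Sum>j\<in>J. \<Sum>a<d. y a * (c j * v j a))"
      by (intro sum.cong refl, subst y[symmetric]) (simp_all add: sum_distrib_left mult.left_commute)
    also have "\<dots> = (\<Sum>a<d. y a * (\<Sum>j\<in>J. c j * v j a))"
      by (subst sum.swap) (simp add: sum_distrib_left)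
    finally show ?thesis using c by simp
  qed
  then show ?thesis using assms(1,2) unfolding basis_of_def indep_def by blast
qed

section \<open>Stability and Gale duality of families of vectors\<close>

definition stable_tuple :: "nat \<Rightarrow> nat \<Rightarrow> (nat \<Rightarrow> nat \<Rightarrow> 'a::field) \<Rightarrow> bool" where
  "stable_tuple d m v \<longleftrightarrow>
     (\<forall>I. I \<noteq> {} \<and> I \<subset> {..<m} \<longrightarrow> (\<exists>J\<subseteq>I. indep d v J \<and> d * card I \<le> m * card J))"

text \<open>Only orthogonality of the two row spaces is required. That they are full annihilators of
  each other follows once \<open>m = d + n\<close> and both families contain a basis.\<close>

definition gale :: "nat \<Rightarrow> nat \<Rightarrow> nat \<Rightarrow> (nat \<Rightarrow> nat \<Rightarrow> 'a::field) \<Rightarrow> (nat \<Rightarrow> nat \<Rightarrow> 'a) \<Rightarrow> bool" where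
  "gale d n m v w \<longleftrightarrow> (\<forall>a<d. \<forall>b<n. (\<Sum>i<m. v i a * w i b) = 0)"

lemma gale_sym: "gale d n m v w \<longleftrightarrow> gale n d m w v"
  unfolding gale_def by (auto simp: mult.commute)

text \<open>Each functional \<open>y\<close> gives a vector in the row space of \<open>w\<close>,
  that is, a linear relation among the \<open>v i\<close>. This is the form in which duality enters
  the arguments below.\<close>

lemma gale_functional:
  assumes "gale d n m v w" "a < d"
  shows "(\<Sum>i<m. (\<Sum>b<n. y b * w i b) * v i a) = 0"
proof -
  have "(\<Sum>i<m. (\<Sum>b<n. y b * w i b) * v i a) = (\<Sum>i<m. \<Sum>b<n. y b * (v i a * w i b))"
    by (simp add: sum_distrib_left sum_distrib_right mult_ac)
  also have "\<dots> = (\<Sum>b<n. y b * (\<Sum>i<m. v i a * w i b))"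
    by (subst sum.swap) (simp add: sum_distrib_left)
  finally show ?thesis using assms by (simp add: gale_def)
qed

text \<open>A functional vanishing on \<open>w j\<close> for all \<open>j\<close> outside
  \<open>J\<close> gives a relation among the \<open>v i\<close> supported in \<open>J\<close>.
  Independence of \<open>J\<close> makes it vanish at all indices, in particular on the basis
  \<open>K\<close>, so the functional is zero.\<close>

lemma gale_complement_basis:
  assumes m: "m = d + n" and g: "gale d n m v w"
    and J: "basis_of d v J" "J \<subseteq> {..<m}" and K: "basis_of n w K" "K \<subseteq> {..<m}"
  shows "basis_of n w ({..<m} - J)"
proof (rule basis_if_annihilator)
  show "finite ({..<m} - J)" by simp
  show "card ({..<m} - J) = n"
    using J m by (simp add: basis_of_def card_Diff_subset)
  fix y assume y: "\<And>j. j \<in> {..<m} - J \<Longrightarrow> (\<Sum>b<n. y b * w j b) = 0"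
  have "(\<Sum>j\<in>J. (\<Sum>b<n. y b * w j b) * v j a) = 0" if "a < d" for a
  proof -
    have "(\<Sum>j\<in>J. (\<Sum>b<n. y b * w j b) * v j a) = (\<Sum>i<m. (\<Sum>b<n. y b * w i b) * v i a)"
      using J y by (intro sum.mono_neutral_left) auto
    then show ?thesis using gale_functional[OF g that] by simp
  qed
  moreover have "indep d v J" using J by (simp add: basis_of_def)
  ultimately have "(\<Sum>b<n. y b * w j b) = 0" if "j \<in> J" for j
    using indepD[of d v J "\<lambda>j. \<Sum>b<n. y b * w j b"] that by blast
  then have "(\<Sum>b<n. y b * w k b) = 0" if "k \<in> K" for k
    using y K(2) that by blast
  then show "\<forall>b<n. y b = 0"
    using basis_annihilator[OF K(1), of y] by blast
qed

text \<open>The stability inequality concerns proper subsets only. For all indices but the last it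
  gives rank at least \<open>d * (m - 1) / m\<close>, which exceeds \<open>d - 1\<close> because
  \<open>d < m\<close>.\<close>

lemma stable_tuple_basis:
  assumes st: "stable_tuple d m v" and m: "0 < d" "d < m"
  shows "\<exists>J. J \<subseteq> {..<m} \<and> basis_of d v J"
proof -
  have "0 \<in> {..<m - 1}" "{..<m - 1} \<subseteq> {..<m}" "{..<m - 1} \<noteq> {..<m}"
    using m by auto
  then have "{..<m - 1} \<noteq> {}" "{..<m - 1} \<subset> {..<m}"
    unfolding psubset_eq by (metis empty_iff, metis)
  then obtain J where J: "J \<subseteq> {..<m - 1}" "indep d v J" "d * (m - 1) \<le> m * card J"
    using st[unfolded stable_tuple_def, rule_format, of "{..<m - 1}"] by auto
  have fin: "finite J" by (rule finite_subset[OF J(1)]) simp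
  have "card J \<ge> d"
  proof (rule ccontr)
    assume "\<not> card J \<ge> d"
    then have "card J + 1 \<le> d" by simp
    then have "m * (card J + 1) \<le> m * d" by (rule mult_le_mono2)
    moreover have "d * (m - 1) + d = d * m" using m by (cases m) auto
    ultimately show False using J(3) m by (simp add: algebra_simps)
  qed
  then have "basis_of d v J" using J fin indep_card_le[of d v J] by (auto simp: basis_of_def)
  moreover have "J \<subseteq> {..<m}" using J by auto
  ultimately show ?thesis by blast
qed

text \<open>Stability of \<open>v\<close> is applied to the complement of \<open>I\<close>. The
  independent set \<open>J\<close> found there extends to a basis \<open>J'\<close>, and
  \<open>I - J'\<close> is independent for \<open>w\<close> as part of a complementary basis. Since
  \<open>I\<close> misses \<open>J\<close>, at most \<open>d - card J\<close> elements of
  \<open>I\<close> are lost, which is few enough.\<close>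

lemma gale_dual_stable:
  assumes m: "m = d + n" and pos: "0 < d" "0 < n" and g: "gale d n m v w"
    and st: "stable_tuple d m v" and K: "basis_of n w K" "K \<subseteq> {..<m}"
  shows "stable_tuple n m w"
  unfolding stable_tuple_def
proof (intro allI impI)
  fix I :: "nat set" assume I: "I \<noteq> {} \<and> I \<subset> {..<m}"
  have finI: "finite I" using I finite_subset by blast
  obtain B where B: "B \<subseteq> {..<m}" "basis_of d v B" using stable_tuple_basis[OF st] pos m by auto
  have "{..<m} - I \<noteq> {}" "{..<m} - I \<subset> {..<m}" using I by auto
  then obtain J where J: "J \<subseteq> {..<m} - I" "indep d v J" "d * card ({..<m} - I) \<le> m * card J"
    using st unfolding stable_tuple_def by meson
  obtain J' where J': "J \<subseteq> J'" "J' \<subseteq> {..<m}" "basis_of d v J'"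
    using extend_to_basis[OF J(2) _ _ B(2,1)] J(1) by auto
  have "basis_of n w ({..<m} - J')" by (rule gale_complement_basis[OF m g J'(3,2) K])
  then have ind: "indep n w (I - J')"
    using I by (auto simp: basis_of_def intro: indep_subset)
  have finJ': "finite J'" "card J' = d" using J' by (auto simp: basis_of_def)
  have "card (I \<inter> J') \<le> card (J' - J)"
    using J finJ' by (intro card_mono) auto
  also have "\<dots> = d - card J" using J'(1) finJ' by (simp add: card_Diff_subset finite_subset)
  finally have 1: "card (I \<inter> J') + card J \<le> d"
    using card_mono[OF finJ'(1) J'(1)] finJ' by linarith
  have 2: "card I = card (I - J') + card (I \<inter> J')"
    using finI card_Int_Diff[of I J'] by simp
  have "card I \<le> m" using I card_mono[of "{..<m}" I] by auto
  then have "d * m \<le> d * card I + m * card J"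
    using J(3) I finI by (simp add: card_Diff_subset psubset_imp_subset diff_mult_distrib2)
  moreover have "m * (card (I \<inter> J') + card J) \<le> m * d" using 1 by (rule mult_le_mono2)
  ultimately have "m * card (I \<inter> J') \<le> d * card I" by (simp add: algebra_simps)
  then have "n * card I \<le> m * card (I - J')" using 2 m by (simp add: algebra_simps)
  then show "\<exists>J\<subseteq>I. indep n w J \<and> n * card I \<le> m * card J" using ind by blast
qed

text \<open>If the bound failed, \<open>K\<close> being completed to a basis \<open>K'\<close>,
  there would be fewer than \<open>n\<close> conditions in asking a functional to vanish on
  \<open>w\<close> over \<open>S - J\<close> and \<open>K' - K\<close>. For a nonzero solution, its
  values weighted by \<open>l\<close> form a relation among the \<open>v j\<close> with
  \<open>j\<close> in \<open>J\<close>, so it vanishes on \<open>J\<close> as well, hence on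
  \<open>K'\<close>, a contradiction.\<close>

lemma gale_rank_bound:
  assumes S: "finite S" and J: "J \<subseteq> S" "indep d v J" and K: "K \<subseteq> S" "indep n w K"
    and B: "basis_of n w B" and l: "\<And>i. i \<in> S \<Longrightarrow> l i \<noteq> 0"
    and g: "\<And>a b. a < d \<Longrightarrow> b < n \<Longrightarrow> (\<Sum>i\<in>S. l i * (v i a * w i b)) = 0"
  shows "card J + card K \<le> card S"
proof (rule ccontr)
  assume *: "\<not> card J + card K \<le> card S"
  have fin: "finite J" "finite K" "finite B" using S J(1) K(1) B by (auto simp: basis_of_def intro: finite_subset)
  obtain K' where K': "K \<subseteq> K'" "K' \<subseteq> K \<union> B" "basis_of n w K'"
    using extend_to_basis[OF K(2), of "K \<union> B" B] fin B by auto
  have finK': "finite K'" "card K' = n" using K' by (auto simp: basis_of_def)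
  have "card ((S - J) \<union> (K' - K)) \<le> card (S - J) + card (K' - K)" by (rule card_Un_le)
  also have "\<dots> = (card S - card J) + (n - card K)"
    using fin K'(1) J(1) finK' by (simp add: card_Diff_subset)
  also have "\<dots> < n"
    using * card_mono[OF S J(1)] card_mono[OF S K(1)] card_mono[OF finK'(1) K'(1)] finK' by linarith
  finally have "card ((S - J) \<union> (K' - K)) < card {..<n}" by simp
  then obtain y where y: "\<And>i. i \<in> (S - J) \<union> (K' - K) \<Longrightarrow> (\<Sum>b<n. y b * w i b) = 0"
      "\<exists>b<n. y b \<noteq> 0"
    using underdetermined_system[of "(S - J) \<union> (K' - K)" "{..<n}" "\<lambda>b i. w i b"] S finK' by auto
  define s where "s = (\<lambda>i. \<Sum>b<n. y b * w i b)"
  have "(\<Sum>j\<in>J. (l j * s j) * v j a) = 0" if "a < d" for a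
  proof -
    have "(\<Sum>j\<in>J. (l j * s j) * v j a) = (\<Sum>i\<in>S. (l i * s i) * v i a)"
      using J S y(1) by (intro sum.mono_neutral_left) (auto simp: s_def)
    also have "\<dots> = (\<Sum>i\<in>S. \<Sum>b<n. y b * (l i * (v i a * w i b)))"
      by (simp add: s_def sum_distrib_left sum_distrib_right mult_ac)
    also have "\<dots> = (\<Sum>b<n. y b * (\<Sum>i\<in>S. l i * (v i a * w i b)))"
      by (subst sum.swap) (simp add: sum_distrib_left)
    finally show ?thesis using g that by simp
  qed
  then have "l j * s j = 0" if "j \<in> J" for j
    using indepD[OF J(2), of "\<lambda>j. l j * s j"] that by blast
  then have "s j = 0" if "j \<in> J" for j
    using that l J(1) by (metis mult_eq_0_iff subsetD)
  then have "s i = 0" if "i \<in> K'" for i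
    using y(1) that K(1) by (metis DiffI UnI1 UnI2 s_def subsetD)
  then show False using basis_annihilator[OF K'(3), of y] y(2) unfolding s_def by blast
qed

lemma gale_weights:
  assumes m: "m = d + n" and pos: "0 < d" "0 < n" and cop: "coprime d m"
    and st: "stable_tuple d m v" "stable_tuple n m w"
    and g: "\<And>a b. a < d \<Longrightarrow> b < n \<Longrightarrow> (\<Sum>i<m. l i * (v i a * w i b)) = 0"
    and nz: "\<exists>i<m. l i \<noteq> 0"
  shows "\<forall>i<m. l i \<noteq> 0"
proof (rule ccontr)
  assume *: "\<not> (\<forall>i<m. l i \<noteq> 0)"
  define S where "S = {i. i < m \<and> l i \<noteq> 0}"
  have S: "S \<noteq> {}" "S \<subset> {..<m}" "finite S" using nz * by (auto simp: S_def)
  obtain J K where J: "J \<subseteq> S" "indep d v J" "d * card S \<le> m * card J"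
    and K: "K \<subseteq> S" "indep n w K" "n * card S \<le> m * card K"
    using st S unfolding stable_tuple_def by meson
  obtain B where B: "basis_of n w B" using stable_tuple_basis[OF st(2)] m pos by auto
  have gS: "(\<Sum>i\<in>S. l i * (v i a * w i b)) = 0" if "a < d" "b < n" for a b
    using g[OF that] S by (subst sum.mono_neutral_left[of "{..<m}"]) (auto simp: S_def)
  have "card J + card K \<le> card S"
    by (rule gale_rank_bound[OF S(3) J(1,2) K(1,2) B _ gS]) (auto simp: S_def)
  then have "m * (card J + card K) \<le> m * card S" by (rule mult_le_mono2)
  \<comment> \<open>The two stability inequalities add up to
    \<open>m * card S \<le> m * (card J + card K)\<close> by \<open>m = d + n\<close>, so the rank
    bound forces equality in both. Coprimality then gives \<open>m dvd card S\<close>.\<close>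
  then have "m * card J = d * card S" using J(3) K(3) m by (simp add: algebra_simps)
  then have "m dvd d * card S" by (metis dvd_triv_left)
  then have "m dvd card S" using cop by (simp add: coprime_commute coprime_dvd_mult_right_iff)
  moreover have "0 < card S" "card S < m"
    using S psubset_card_mono[of "{..<m}" S] by (auto simp: card_gt_0_iff)
  ultimately show False using dvd_imp_le by fastforce
qed

text \<open>Taking complements twice shows that \<open>B\<close> is a basis for \<open>v'\<close> as
  well. The matrix \<open>h\<close> is chosen to be correct on \<open>B\<close>; the error elsewhere
  is a relation among the \<open>w i\<close> supported off \<open>B\<close>, where \<open>w\<close>
  is independent. The second conclusion says that \<open>h\<close> has trivial left kernel, from
  which its invertibility is derived later.\<close>

lemma gale_unique:
  assumes m: "m = d + n" and g: "gale d n m v w" "gale d n m v' w"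
    and B: "basis_of d v B" "B \<subseteq> {..<m}" and B': "basis_of d v' B'" "B' \<subseteq> {..<m}"
    and K: "basis_of n w K" "K \<subseteq> {..<m}"
  shows "\<exists>h. (\<forall>i<m. \<forall>a<d. v' i a = (\<Sum>b<d. h a b * v i b)) \<and>
    (\<forall>y. (\<forall>b<d. (\<Sum>a<d. y a * h a b) = 0) \<longrightarrow> (\<forall>a<d. y a = 0))"
proof -
  have C: "basis_of n w ({..<m} - B)" by (rule gale_complement_basis[OF m g(1) B K])
  have "basis_of d v' ({..<m} - ({..<m} - B))"
    using gale_complement_basis[OF _ _ C _ B'] m g(2) by (simp add: gale_sym)
  then have v'B: "basis_of d v' B" using B(2) by (simp add: double_diff)
  have "\<exists>y. \<forall>j\<in>B. (\<Sum>b<d. y b * v j b) = v' j a" for a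
    by (rule basis_functional[OF B(1)])
  then obtain h where h: "\<And>a j. j \<in> B \<Longrightarrow> (\<Sum>b<d. h a b * v j b) = v' j a" by metis
  have eq: "v' i a = (\<Sum>b<d. h a b * v i b)" if "i < m" "a < d" for i a
  proof (cases "i \<in> B")
    case False
    define u where "u = (\<lambda>i. v' i a - (\<Sum>b<d. h a b * v i b))"
    have "(\<Sum>i\<in>{..<m} - B. u i * w i c) = 0" if c: "c < n" for c
    proof -
      have "(\<Sum>i\<in>{..<m} - B. u i * w i c) = (\<Sum>i<m. u i * w i c)"
        using h by (intro sum.mono_neutral_left) (auto simp: u_def)
      also have "\<dots> = (\<Sum>i<m. v' i a * w i c) - (\<Sum>i<m. (\<Sum>b<d. h a b * v i b) * w i c)"
        by (simp add: u_def left_diff_distrib sum_subtractf)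
      also have "\<dots> = 0"
        using g(2) \<open>a < d\<close> c gale_functional[OF iffD1[OF gale_sym g(1)] c, of "h a"]
        by (simp add: gale_def)
      finally show ?thesis .
    qed
    moreover have "indep n w ({..<m} - B)" "i \<in> {..<m} - B"
      using C False that by (auto simp: basis_of_def)
    ultimately have "u i = 0" using indepD[of n w "{..<m} - B" u] by blast
    then show ?thesis by (simp add: u_def)
  qed (simp add: h)
  have "y a = 0" if y: "\<And>b. b < d \<Longrightarrow> (\<Sum>a<d. y a * h a b) = 0" and "a < d" for y a
  proof (rule basis_annihilator[OF v'B _ \<open>a < d\<close>])
    fix j assume "j \<in> B"
    have "(\<Sum>a<d. y a * v' j a) = (\<Sum>a<d. \<Sum>b<d. y a * h a b * v j b)"
      by (simp add: h[OF \<open>j \<in> B\<close>, symmetric] sum_distrib_left mult.assoc)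
    also have "\<dots> = (\<Sum>b<d. (\<Sum>a<d. y a * h a b) * v j b)"
      by (subst sum.swap) (simp add: sum_distrib_right)
    finally show "(\<Sum>a<d. y a * v' j a) = 0" using y by simp
  qed
  with eq show ?thesis by blast
qed


section \<open>Polynomial functions of tuples of vectors\<close>

text \<open>Coefficients of equal monomials are collected, so that sums and products of polynomials
  can be expanded without regard to exponents that occur several times.\<close>

lemma multihomI:
  assumes "finite X" "\<And>x i. x \<in> X \<Longrightarrow> i < m \<Longrightarrow> (\<Sum>j<d. ex x i j) = k i"
    and F: "\<And>v. F v = (\<Sum>x\<in>X. c x * (\<Prod>i<m. \<Prod>j<d. vec_index (v i) j ^ ex x i j))"
  shows "multihom d m k F"
proof -
  have "F v = (\<Sum>e\<in>ex ` X. (\<Sum>x\<in>{x \<in> X. ex x = e}. c x) * (\<Prod>i<m. \<Prod>j<d. vec_index (v i) j ^ e i j))" for v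
    unfolding F by (subst sum.image_gen[OF assms(1), of _ ex])
      (auto simp: sum_distrib_right intro!: sum.cong)
  then have "F = (\<lambda>v. \<Sum>e\<in>ex ` X. (\<Sum>x\<in>{x \<in> X. ex x = e}. c x) * (\<Prod>i<m. \<Prod>j<d. vec_index (v i) j ^ e i j))"
    by blast
  moreover have "finite (ex ` X)" "\<forall>e\<in>ex ` X. \<forall>i<m. (\<Sum>j<d. e i j) = k i" using assms by auto
  ultimately show ?thesis unfolding multihom_def
    by (intro exI[of _ "ex ` X"] exI[of _ "\<lambda>e. \<Sum>x\<in>{x \<in> X. ex x = e}. c x"] conjI)
qed

lemma multihom_const: "multihom d m (\<lambda>_. 0) (\<lambda>_. c)"
  by (rule multihomI[where X = "{()}" and c = "\<lambda>_. c" and ex = "\<lambda>_ _ _. 0"]) auto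

lemma multihom_zero: "multihom d m k (\<lambda>_. 0)"
  by (rule multihomI[where X = "{}"]) auto

lemma multihom_coord:
  assumes "i < m" "j < d"
  shows "multihom d m (\<lambda>l. if l = i then 1 else 0) (\<lambda>v. vec_index (v i) j)"
proof (rule multihomI[where X = "{()}" and c = "\<lambda>_. 1" and ex = "\<lambda>_ l b. if l = i \<and> b = j then 1 else 0"])
  show "(\<Sum>b<d. if l = i \<and> b = j then 1 else 0) = (if l = i then 1 else 0)" if "l < m" for l
    using assms by (cases "l = i") auto
  show "vec_index (v i) j = (\<Sum>x\<in>{()}. 1 * (\<Prod>l<m. \<Prod>b<d. vec_index (v l) b ^ (if l = i \<and> b = j then 1 else 0)))"
    for v :: "nat \<Rightarrow> complex vec"
  proof -
    have "(\<Prod>l<m. \<Prod>b<d. vec_index (v l) b ^ (if l = i \<and> b = j then 1 else 0)) =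
        (\<Prod>l<m. if l = i then vec_index (v l) j else 1)"
    proof (intro prod.cong refl)
      fix l
      have "(\<Prod>b<d. vec_index (v l) b ^ (if l = i \<and> b = j then 1 else 0)) =
          (\<Prod>b<d. if b = j then (if l = i then vec_index (v l) b else 1) else 1)"
        by (intro prod.cong) auto
      then show "(\<Prod>b<d. vec_index (v l) b ^ (if l = i \<and> b = j then 1 else 0)) =
          (if l = i then vec_index (v l) j else 1)" using assms by simp
    qed
    then show ?thesis using assms by simp
  qed
qed auto

lemma multihom_add:
  assumes "multihom d m k F" "multihom d m k G"
  shows "multihom d m k (\<lambda>v. F v + G v)"
proof -
  obtain E a where E: "finite E" "\<forall>e\<in>E. \<forall>i<m. (\<Sum>j<d. e i j) = k i"
      "F = (\<lambda>v. \<Sum>e\<in>E. a e * (\<Prod>i<m. \<Prod>j<d. vec_index (v i) j ^ e i j))"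
    using assms(1) unfolding multihom_def by blast
  obtain E' a' where E': "finite E'" "\<forall>e\<in>E'. \<forall>i<m. (\<Sum>j<d. e i j) = k i"
      "G = (\<lambda>v. \<Sum>e\<in>E'. a' e * (\<Prod>i<m. \<Prod>j<d. vec_index (v i) j ^ e i j))"
    using assms(2) unfolding multihom_def by blast
  show ?thesis
    by (rule multihomI[where X = "E <+> E'" and c = "case_sum a a'" and ex = "case_sum (\<lambda>e. e) (\<lambda>e. e)"])
      (use E E' in \<open>auto simp: sum.Plus\<close>)
qed

lemma multihom_mult:
  assumes "multihom d m k F" "multihom d m l G"
  shows "multihom d m (\<lambda>i. k i + l i) (\<lambda>v. F v * G v)"
proof -
  obtain E a where E: "finite E" "\<forall>e\<in>E. \<forall>i<m. (\<Sum>j<d. e i j) = k i"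
      "F = (\<lambda>v. \<Sum>e\<in>E. a e * (\<Prod>i<m. \<Prod>j<d. vec_index (v i) j ^ e i j))"
    using assms(1) unfolding multihom_def by blast
  obtain E' a' where E': "finite E'" "\<forall>e\<in>E'. \<forall>i<m. (\<Sum>j<d. e i j) = l i"
      "G = (\<lambda>v. \<Sum>e\<in>E'. a' e * (\<Prod>i<m. \<Prod>j<d. vec_index (v i) j ^ e i j))"
    using assms(2) unfolding multihom_def by blast
  show ?thesis
  proof (rule multihomI[where X = "E \<times> E'" and c = "\<lambda>(e, e'). a e * a' e'"
        and ex = "\<lambda>(e, e') i j. e i j + e' i j"])
    show "F v * G v = (\<Sum>x\<in>E \<times> E'. (case x of (e, e') \<Rightarrow> a e * a' e') *
        (\<Prod>i<m. \<Prod>j<d. vec_index (v i) j ^ (case x of (e, e') \<Rightarrow> \<lambda>i j. e i j + e' i j) i j))" for v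
      unfolding E(3) E'(3) sum_product sum.cartesian_product
      by (intro sum.cong) (auto simp: power_add prod.distrib)
  qed (use E E' in \<open>auto simp: sum.distrib\<close>)
qed

lemma multihom_sum:
  "finite X \<Longrightarrow> (\<And>x. x \<in> X \<Longrightarrow> multihom d m k (F x)) \<Longrightarrow> multihom d m k (\<lambda>v. \<Sum>x\<in>X. F x v)"
  by (induction X rule: finite_induct) (auto intro: multihom_zero multihom_add)

lemma multihom_scale:
  assumes "multihom d m k F" "\<And>i. i < m \<Longrightarrow> dim_vec (v i) = d"
  shows "F (\<lambda>i. t i \<cdot>\<^sub>v v i) = (\<Prod>i<m. t i ^ k i) * F v"
proof -
  obtain E a where E: "finite E" "\<forall>e\<in>E. \<forall>i<m. (\<Sum>j<d. e i j) = k i"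
      "F = (\<lambda>v. \<Sum>e\<in>E. a e * (\<Prod>i<m. \<Prod>j<d. vec_index (v i) j ^ e i j))"
    using assms(1) unfolding multihom_def by blast
  have "(\<Prod>i<m. \<Prod>j<d. vec_index (t i \<cdot>\<^sub>v v i) j ^ e i j) =
      (\<Prod>i<m. t i ^ k i) * (\<Prod>i<m. \<Prod>j<d. vec_index (v i) j ^ e i j)" if "e \<in> E" for e
  proof -
    have "(\<Prod>j<d. vec_index (t i \<cdot>\<^sub>v v i) j ^ e i j) = t i ^ k i * (\<Prod>j<d. vec_index (v i) j ^ e i j)"
      if "i < m" for i
      using assms(2)[OF that] E(2) \<open>e \<in> E\<close> that
      by (simp add: power_mult_distrib prod.distrib power_sum[symmetric])
    then show ?thesis by (simp add: prod.distrib)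
  qed
  then show ?thesis unfolding E(3) by (simp add: sum_distrib_left mult.left_commute)
qed

lemma multihom_eq:
  assumes "multihom d m k F" "\<And>i. i < m \<Longrightarrow> v i = v' i"
  shows "F v = F v'"
  using assms unfolding multihom_def by auto

text \<open>Polynomials with no condition on degrees. They suffice for the determinants and
  cofactors below, whose multidegrees would be tedious to follow; homogeneity is restored by
  splitting into components.\<close>

inductive polyfun :: "nat \<Rightarrow> nat \<Rightarrow> ((nat \<Rightarrow> complex vec) \<Rightarrow> complex) \<Rightarrow> bool" for d m where
  polyfun_const: "polyfun d m (\<lambda>_. c)"
| polyfun_coord: "i < m \<Longrightarrow> j < d \<Longrightarrow> polyfun d m (\<lambda>v. vec_index (v i) j)"
| polyfun_add: "polyfun d m F \<Longrightarrow> polyfun d m G \<Longrightarrow> polyfun d m (\<lambda>v. F v + G v)"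
| polyfun_mult: "polyfun d m F \<Longrightarrow> polyfun d m G \<Longrightarrow> polyfun d m (\<lambda>v. F v * G v)"

lemma polyfun_sum:
  "(\<And>x. x \<in> X \<Longrightarrow> polyfun d m (F x)) \<Longrightarrow> polyfun d m (\<lambda>v. \<Sum>x\<in>X. F x v)"
  by (induction X rule: infinite_finite_induct) (auto intro: polyfun.intros)

lemma polyfun_prod:
  "(\<And>x. x \<in> X \<Longrightarrow> polyfun d m (F x)) \<Longrightarrow> polyfun d m (\<lambda>v. \<Prod>x\<in>X. F x v)"
  by (induction X rule: infinite_finite_induct) (auto intro: polyfun.intros)

lemma polyfun_power: "polyfun d m F \<Longrightarrow> polyfun d m (\<lambda>v. F v ^ e)"
  by (induction e) (auto intro: polyfun.intros)

lemma polyfun_uminus: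
  assumes "polyfun d m F"
  shows "polyfun d m (\<lambda>v. - F v)"
  using polyfun_mult[OF polyfun_const[of d m "-1"] assms] by simp

lemma polyfun_det:
  assumes "\<And>i j. i < n \<Longrightarrow> j < n \<Longrightarrow> polyfun d m (\<lambda>v. f v i j)"
  shows "polyfun d m (\<lambda>v. Determinant.det (mat n n (\<lambda>(i, j). f v i j)))"
proof -
  have "Determinant.det (mat n n (\<lambda>(i, j). f v i j)) =
      (\<Sum>p\<in>{p. p permutes {0..<n}}. signof p * (\<Prod>i = 0..<n. f v i (p i)))" for v
    unfolding Determinant.det_def by (auto intro!: sum.cong prod.cong simp: permutes_in_image)
  moreover have "polyfun d m (\<lambda>v. \<Sum>p\<in>{p. p permutes {0..<n}}. signof p * (\<Prod>i = 0..<n. f v i (p i)))"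
    by (intro polyfun_sum polyfun_mult polyfun_const polyfun_prod assms) (auto simp: permutes_in_image)
  ultimately show ?thesis by simp
qed

lemma polyfun_compose_multihom:
  assumes "multihom n m k F" "\<And>i j. i < m \<Longrightarrow> j < n \<Longrightarrow> polyfun d m' (\<lambda>v. vec_index (b v i) j)"
  shows "polyfun d m' (\<lambda>v. F (b v))"
  using assms(1) unfolding multihom_def
  by (auto intro!: polyfun_sum polyfun_mult polyfun_const polyfun_prod polyfun_power assms(2))

text \<open>The degrees are normalized outside \<open>{..<m}\<close>, so that they are determined by the monomials
  in the scaling factors.\<close>

lemma polyfun_decompose:
  assumes "polyfun d m Q"
  shows "\<exists>K C. finite K \<and> (\<forall>k\<in>K. \<forall>i\<ge>m. k i = 0) \<and> (\<forall>k. multihom d m k (C k)) \<and>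
    (\<forall>k. k \<notin> K \<longrightarrow> C k = (\<lambda>_. 0)) \<and> (\<forall>v. Q v = (\<Sum>k\<in>K. C k v))"
  using assms
proof induction
  case (polyfun_const c)
  show ?case
    by (rule exI[of _ "{\<lambda>_. 0}"], rule exI[of _ "\<lambda>k. if k = (\<lambda>_. 0) then (\<lambda>_. c) else (\<lambda>_. 0)"])
      (auto intro: multihom_const multihom_zero)
next
  case (polyfun_coord i j)
  let ?k = "\<lambda>l. if l = i then 1 else 0"
  show ?case
    by (rule exI[of _ "{?k}"], rule exI[of _ "\<lambda>k. if k = ?k then (\<lambda>v. vec_index (v i) j) else (\<lambda>_. 0)"])
      (use polyfun_coord in \<open>auto intro: multihom_coord multihom_zero\<close>)
next
  case (polyfun_add F G)
  obtain K C where K: "finite K" "\<forall>k\<in>K. \<forall>i\<ge>m. k i = 0" "\<And>k. multihom d m k (C k)"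
      "\<And>k. k \<notin> K \<Longrightarrow> C k = (\<lambda>_. 0)" "\<And>v. F v = (\<Sum>k\<in>K. C k v)"
    using polyfun_add.IH(1) by auto
  obtain L D where L: "finite L" "\<forall>k\<in>L. \<forall>i\<ge>m. k i = 0" "\<And>k. multihom d m k (D k)"
      "\<And>k. k \<notin> L \<Longrightarrow> D k = (\<lambda>_. 0)" "\<And>v. G v = (\<Sum>k\<in>L. D k v)"
    using polyfun_add.IH(2) by auto
  have "F v + G v = (\<Sum>k\<in>K \<union> L. C k v + D k v)" for v
  proof -
    \<comment> \<open>Components outside their index set are zero, so both sums extend to the
      union.\<close>
    have "(\<Sum>k\<in>K. C k v) = (\<Sum>k\<in>K \<union> L. C k v)" "(\<Sum>k\<in>L. D k v) = (\<Sum>k\<in>K \<union> L. D k v)"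
      using K L by (auto intro!: sum.mono_neutral_left)
    then show ?thesis by (simp add: K(5) L(5) sum.distrib)
  qed
  then show ?case using K(1-4) L(1-4)
    by (intro exI[of _ "K \<union> L"] exI[of _ "\<lambda>k v. C k v + D k v"]) (auto intro: multihom_add)
next
  case (polyfun_mult F G)
  obtain K C where K: "finite K" "\<forall>k\<in>K. \<forall>i\<ge>m. k i = 0" "\<And>k. multihom d m k (C k)"
      "\<And>k. k \<notin> K \<Longrightarrow> C k = (\<lambda>_. 0)" "\<And>v. F v = (\<Sum>k\<in>K. C k v)"
    using polyfun_mult.IH(1) by auto
  obtain L D where L: "finite L" "\<forall>k\<in>L. \<forall>i\<ge>m. k i = 0" "\<And>k. multihom d m k (D k)"
      "\<And>k. k \<notin> L \<Longrightarrow> D k = (\<lambda>_. 0)" "\<And>v. G v = (\<Sum>k\<in>L. D k v)"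
    using polyfun_mult.IH(2) by auto
  \<comment> \<open>Products of components are regrouped by the sum of their multidegrees.\<close>
  define s :: "(nat \<Rightarrow> nat) \<times> (nat \<Rightarrow> nat) \<Rightarrow> nat \<Rightarrow> nat" where "s = (\<lambda>(k, l) i. k i + l i)"
  define P where "P = (\<lambda>k v. \<Sum>x\<in>{x \<in> K \<times> L. s x = k}. C (fst x) v * D (snd x) v)"
  have fin: "finite (K \<times> L)" using K L by simp
  have "F v * G v = (\<Sum>x\<in>K \<times> L. C (fst x) v * D (snd x) v)" for v
    unfolding K(5) L(5) sum_product sum.cartesian_product by (simp add: case_prod_beta)
  also have "\<And>v. (\<Sum>x\<in>K \<times> L. C (fst x) v * D (snd x) v) = (\<Sum>k\<in>s ` (K \<times> L). P k v)"
    unfolding P_def by (rule sum.image_gen[OF fin])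
  finally have "\<forall>v. F v * G v = (\<Sum>k\<in>s ` (K \<times> L). P k v)" by blast
  moreover have "multihom d m k (P k)" for k
    unfolding P_def
  proof (rule multihom_sum)
    fix x assume "x \<in> {x \<in> K \<times> L. s x = k}"
    then have "k = (\<lambda>i. fst x i + snd x i)" by (auto simp: s_def)
    then show "multihom d m k (\<lambda>v. C (fst x) v * D (snd x) v)"
      using multihom_mult[OF K(3) L(3)] by simp
  qed (use fin in simp)
  moreover have "P k = (\<lambda>_. 0)" if "k \<notin> s ` (K \<times> L)" for k
  proof -
    have *: "{x \<in> K \<times> L. s x = k} = {}" using that by auto
    show ?thesis unfolding P_def * by simp
  qed
  moreover have "finite (s ` (K \<times> L))" using fin by simp
  moreover have "\<forall>k\<in>s ` (K \<times> L). \<forall>i\<ge>m. k i = 0" using K(2) L(2) by (auto simp: s_def)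
  ultimately show ?case by (intro exI[of _ "s ` (K \<times> L)"] exI[of _ P]) blast
qed

text \<open>Dedekind's argument for the linear independence of characters.\<close>

lemma monomials_independent:
  fixes c :: "(nat \<Rightarrow> nat) \<Rightarrow> complex"
  assumes "finite K" "\<And>k i. k \<in> K \<Longrightarrow> i \<ge> m \<Longrightarrow> k i = 0"
    and "\<And>t. (\<And>i. t i \<noteq> 0) \<Longrightarrow> (\<Sum>k\<in>K. c k * (\<Prod>i<m. t i ^ k i)) = 0" and "k \<in> K"
  shows "c k = 0"
  using assms
proof (induction K arbitrary: c k rule: finite_induct)
  case (insert l K)
  define \<chi> where "\<chi> = (\<lambda>k (t :: nat \<Rightarrow> complex). \<Prod>i<m. t i ^ k i)"
  have \<chi>_mult: "\<chi> k (\<lambda>i. t i * s i) = \<chi> k t * \<chi> k s" for k t s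
    by (simp add: \<chi>_def power_mult_distrib prod.distrib)
  have eq: "c l * \<chi> l t + (\<Sum>k\<in>K. c k * \<chi> k t) = 0" if "\<And>i. t i \<noteq> 0" for t
    using insert.prems(2)[of t] that insert.hyps by (simp add: \<chi>_def)
  have cK: "c k = 0" if k: "k \<in> K" for k
  proof -
    have "k \<noteq> l" using insert.hyps k by auto
    then obtain i where i: "k i \<noteq> l i" by auto
    then have "i < m" using insert.prems(1)[of k i] insert.prems(1)[of l i] k by (metis insertCI not_le)
    \<comment> \<open>Doubling a coordinate in which the exponents of \<open>k\<close> and
      \<open>l\<close> differ separates the two characters.\<close>
    define s :: "nat \<Rightarrow> complex" where "s = (\<lambda>j. if j = i then 2 else 1)"
    have s: "s j \<noteq> 0" for j by (simp add: s_def)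
    have \<chi>s: "\<chi> k s = 2 ^ k i" for k
    proof -
      have "\<chi> k s = (\<Prod>j<m. if j = i then 2 ^ k j else 1)"
        unfolding \<chi>_def s_def by (intro prod.cong) auto
      then show ?thesis using \<open>i < m\<close> by simp
    qed
    \<comment> \<open>The relation at \<open>t * s\<close> minus \<open>\<chi> l s\<close> times the
      relation at \<open>t\<close> has no term for \<open>l\<close>, so the induction hypothesis
      applies to it.\<close>
    have "(\<Sum>k\<in>K. (c k * (\<chi> k s - \<chi> l s)) * (\<Prod>i<m. t i ^ k i)) = 0" if t: "\<And>i. t i \<noteq> 0" for t
    proof -
      have "c l * \<chi> l (\<lambda>i. t i * s i) + (\<Sum>k\<in>K. c k * \<chi> k (\<lambda>i. t i * s i)) = 0"
        by (rule eq) (use t s in auto)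
      then have a: "c l * \<chi> l t * \<chi> l s + (\<Sum>k\<in>K. c k * (\<chi> k t * \<chi> k s)) = 0"
        by (simp add: \<chi>_mult mult.assoc)
      have b: "c l * \<chi> l t * \<chi> l s + (\<Sum>k\<in>K. c k * \<chi> k t * \<chi> l s) = 0"
        using arg_cong[OF eq[OF t], of "\<lambda>x. x * \<chi> l s"] by (simp add: distrib_right sum_distrib_right)
      have "(\<Sum>k\<in>K. (c k * (\<chi> k s - \<chi> l s)) * \<chi> k t) =
          (\<Sum>k\<in>K. c k * (\<chi> k t * \<chi> k s)) - (\<Sum>k\<in>K. c k * \<chi> k t * \<chi> l s)"
        unfolding sum_subtractf[symmetric] by (intro sum.cong) (auto simp: algebra_simps)
      also have "\<dots> = 0"
        by (subst add_diff_cancel_left[symmetric, of _ _ "c l * \<chi> l t * \<chi> l s"]) (simp only: a b diff_self)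
      finally show ?thesis by (simp only: \<chi>_def)
    qed
    then have "c k * (\<chi> k s - \<chi> l s) = 0"
      using insert.IH[of "\<lambda>k. c k * (\<chi> k s - \<chi> l s)" k] insert.prems(1) k by blast
    moreover have "\<chi> k s \<noteq> \<chi> l s"
    proof
      assume "\<chi> k s = \<chi> l s"
      then have "(2::complex) ^ k i = 2 ^ l i" by (simp add: \<chi>s)
      then have "norm ((2::complex) ^ k i) = norm ((2::complex) ^ l i)" by simp
      then have "(2::real) ^ k i = 2 ^ l i" by (simp add: norm_power)
      then show False using i by simp
    qed
    ultimately show ?thesis by simp
  qed
  have "c l = 0" using eq[of "\<lambda>_. 1"] cK by (simp add: \<chi>_def)
  then show ?case using cK insert.prems(3) by auto
qed simp


section \<open>The Zariski topology and regular functions\<close>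

definition line :: "complex vec \<Rightarrow> complex vec set" where
  "line u = {c \<cdot>\<^sub>v u | c. True}"

definition tuple_of :: "nat \<Rightarrow> (nat \<Rightarrow> complex vec) \<Rightarrow> point_tuple" where
  "tuple_of m v = (\<lambda>i\<in>{..<m}. line (v i))"

definition nonzero_vecs :: "nat \<Rightarrow> nat \<Rightarrow> (nat \<Rightarrow> complex vec) \<Rightarrow> bool" where
  "nonzero_vecs d m v \<longleftrightarrow> (\<forall>i<m. v i \<in> carrier_vec d \<and> v i \<noteq> 0\<^sub>v d)"

lemma line_smult:
  assumes "c \<noteq> 0"
  shows "line (c \<cdot>\<^sub>v u) = line u"
proof
  show "line (c \<cdot>\<^sub>v u) \<subseteq> line u"
    by (auto simp: line_def smult_smult_assoc)
  show "line u \<subseteq> line (c \<cdot>\<^sub>v u)"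
  proof
    fix x assume "x \<in> line u"
    then obtain a where "x = a \<cdot>\<^sub>v u" by (auto simp: line_def)
    then have "x = (a / c) \<cdot>\<^sub>v (c \<cdot>\<^sub>v u)" using assms by (simp add: smult_smult_assoc)
    then show "x \<in> line (c \<cdot>\<^sub>v u)" by (auto simp: line_def)
  qed
qed

lemma self_in_line: "u \<in> line u"
proof -
  have "u = 1 \<cdot>\<^sub>v u" by simp
  then show ?thesis unfolding line_def by blast
qed

lemma smult_eq_zero_iff:
  assumes "u \<in> carrier_vec d"
  shows "c \<cdot>\<^sub>v u = 0\<^sub>v d \<longleftrightarrow> c = (0::complex) \<or> u = 0\<^sub>v d"
  using assms by (auto simp: vec_eq_iff)

lemma line_eqD:
  assumes "line u = line u'" "u' \<in> carrier_vec d" "u' \<noteq> 0\<^sub>v d"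
  shows "\<exists>c. c \<noteq> 0 \<and> u' = c \<cdot>\<^sub>v u"
proof -
  have "u' \<in> line u" using self_in_line[of u'] assms(1) by simp
  then obtain c where c: "u' = c \<cdot>\<^sub>v u" by (auto simp: line_def)
  moreover have "c \<noteq> 0"
  proof
    assume "c = 0"
    with c have "u' = 0\<^sub>v (dim_vec u)" by (auto simp: vec_eq_iff)
    moreover have "dim_vec u = d" using c assms(2) by auto
    ultimately show False using assms(3) by simp
  qed
  ultimately show ?thesis by blast
qed

lemma proj_space_eq: "proj_space d = {line u | u. u \<in> carrier_vec d \<and> u \<noteq> 0\<^sub>v d}"
  unfolding proj_space_def line_def ..

lemma tuple_of_in_proj_tuples: "nonzero_vecs d m v \<Longrightarrow> tuple_of m v \<in> proj_tuples d m"
  unfolding tuple_of_def proj_tuples_def proj_space_eq nonzero_vecs_def by auto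

lemma reps_iff:
  assumes "p \<in> proj_tuples d m"
  shows "v \<in> reps d m p \<longleftrightarrow> nonzero_vecs d m v \<and> tuple_of m v = p"
proof
  assume v: "v \<in> reps d m p"
  have *: "v i \<in> carrier_vec d \<and> v i \<noteq> 0\<^sub>v d \<and> line (v i) = p i" if "i < m" for i
  proof -
    have "p i \<in> proj_space d" using assms that by (auto simp: proj_tuples_def)
    then obtain u where u: "p i = line u" "u \<in> carrier_vec d" "u \<noteq> 0\<^sub>v d"
      by (auto simp: proj_space_eq)
    have "v i \<in> line u" "v i \<noteq> 0\<^sub>v d" using v that u(1) by (auto simp: reps_def)
    then obtain c where c: "v i = c \<cdot>\<^sub>v u" "v i \<noteq> 0\<^sub>v d" unfolding line_def by blast
    then have "c \<noteq> 0" using u by (auto simp: smult_eq_zero_iff)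
    then show ?thesis using c u by (simp add: line_smult)
  qed
  moreover have "tuple_of m v = p"
    by (rule extensionalityI[of _ "{..<m}"])
      (use * assms in \<open>auto simp: tuple_of_def proj_tuples_def PiE_def\<close>)
  ultimately show "nonzero_vecs d m v \<and> tuple_of m v = p" by (auto simp: nonzero_vecs_def)
next
  assume "nonzero_vecs d m v \<and> tuple_of m v = p"
  then show "v \<in> reps d m p"
    by (auto simp: reps_def nonzero_vecs_def tuple_of_def self_in_line)
qed

lemma reps_tuple_of:
  "nonzero_vecs d m v \<Longrightarrow> v' \<in> reps d m (tuple_of m v) \<longleftrightarrow> nonzero_vecs d m v' \<and> tuple_of m v' = tuple_of m v"
  by (rule reps_iff[OF tuple_of_in_proj_tuples])

lemma proj_tuples_obtain:
  assumes "p \<in> proj_tuples d m"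
  obtains v where "nonzero_vecs d m v" "p = tuple_of m v"
proof -
  have "\<exists>u. u \<in> carrier_vec d \<and> u \<noteq> 0\<^sub>v d \<and> p i = line u" if "i < m" for i
    using assms that by (auto simp: proj_tuples_def proj_space_eq PiE_iff)
  then obtain v where v: "\<And>i. i < m \<Longrightarrow> v i \<in> carrier_vec d \<and> v i \<noteq> 0\<^sub>v d \<and> p i = line (v i)"
    by metis
  then have "v \<in> reps d m p" by (auto simp: reps_def self_in_line)
  then have "nonzero_vecs d m v" "tuple_of m v = p" by (simp_all add: reps_iff[OF assms])
  then show ?thesis by (rule that[OF _ sym])
qed

lemma tuple_of_scale:
  "(\<And>i. i < m \<Longrightarrow> t i \<noteq> 0) \<Longrightarrow> tuple_of m (\<lambda>i. t i \<cdot>\<^sub>v v i) = tuple_of m v"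
  unfolding tuple_of_def by (intro restrict_ext) (simp add: line_smult)

lemma nonzero_vecs_scale:
  "nonzero_vecs d m v \<Longrightarrow> (\<And>i. i < m \<Longrightarrow> t i \<noteq> 0) \<Longrightarrow> nonzero_vecs d m (\<lambda>i. t i \<cdot>\<^sub>v v i)"
  by (auto simp: nonzero_vecs_def smult_eq_zero_iff)

lemma tuple_of_eqD:
  assumes "tuple_of m v = tuple_of m v'" "nonzero_vecs d m v'"
  obtains t where "\<And>i. t i \<noteq> 0" "\<And>i. i < m \<Longrightarrow> v' i = t i \<cdot>\<^sub>v v i"
proof -
  \<comment> \<open>At indices not below \<open>m\<close> the factor is set to 1, so that the
    scaling is nonzero everywhere.\<close>
  have "\<exists>c. c \<noteq> 0 \<and> (i < m \<longrightarrow> v' i = c \<cdot>\<^sub>v v i)" for i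
  proof (cases "i < m")
    case True
    then have "line (v i) = line (v' i)"
      using fun_cong[OF assms(1), of i] by (simp add: tuple_of_def)
    then show ?thesis using line_eqD[of "v i" "v' i" d] assms(2) True by (auto simp: nonzero_vecs_def)
  qed (auto intro: exI[of _ 1])
  then show ?thesis using that by metis
qed

text \<open>Rescaling the vectors multiplies \<open>F\<close> by a monomial in nonzero factors, so
  its non-vanishing depends on the points alone. Testing one representative therefore decides it for
  all.\<close>

lemma multihom_nonzero_cong:
  assumes "multihom d m k F" "tuple_of m v = tuple_of m v'" "nonzero_vecs d m v" "nonzero_vecs d m v'"
    and "F v \<noteq> 0"
  shows "F v' \<noteq> 0"
proof -
  obtain t where t: "\<And>i. t i \<noteq> 0" "\<And>i. i < m \<Longrightarrow> v' i = t i \<cdot>\<^sub>v v i"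
    using tuple_of_eqD[OF assms(2,4)] by blast
  have "F v' = F (\<lambda>i. t i \<cdot>\<^sub>v v i)" by (rule multihom_eq[OF assms(1)]) (rule t)
  also have "\<dots> = (\<Prod>i<m. t i ^ k i) * F v"
    by (rule multihom_scale[OF assms(1)]) (use assms(3) in \<open>auto simp: nonzero_vecs_def\<close>)
  finally show ?thesis using assms(5) t(1) by simp
qed

section \<open>Basic open sets and local criteria for openness and regularity\<close>

definition nonvanishing :: "nat \<Rightarrow> nat \<Rightarrow> ((nat \<Rightarrow> complex vec) \<Rightarrow> complex) \<Rightarrow> point_tuple set" where
  "nonvanishing d m F = {p \<in> proj_tuples d m. \<forall>v \<in> reps d m p. F v \<noteq> 0}"

lemma tuple_of_in_nonvanishing:
  assumes "multihom d m k F" "nonzero_vecs d m v"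
  shows "tuple_of m v \<in> nonvanishing d m F \<longleftrightarrow> F v \<noteq> 0"
  using multihom_nonzero_cong[OF assms(1) _ assms(2)] assms(2)
  by (auto simp: nonvanishing_def reps_tuple_of tuple_of_in_proj_tuples)

lemma openin_nonvanishing: "multihom d m k F \<Longrightarrow> openin (zariski d m) (nonvanishing d m F)"
  unfolding zariski_def nonvanishing_def by (rule topology_generated_by_Basis) blast

lemma nonvanishing_const: "nonvanishing d m (\<lambda>_. 1) = proj_tuples d m"
  by (auto simp: nonvanishing_def)

lemma topspace_zariski: "topspace (zariski d m) = proj_tuples d m"
proof
  show "topspace (zariski d m) \<subseteq> proj_tuples d m"
    unfolding zariski_def topology_generated_by_topspace by blast
  show "proj_tuples d m \<subseteq> topspace (zariski d m)"
    using openin_subset[OF openin_nonvanishing[OF multihom_const[of d m 1]]]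
    by (simp add: nonvanishing_const)
qed

text \<open>The generating sets form a base and not only a subbase, because the intersection of two
  non-vanishing loci is that of the product.\<close>

lemma zariski_neighbourhood:
  assumes "openin (zariski d m) U" "nonzero_vecs d m v" "tuple_of m v \<in> U"
  shows "\<exists>k F. multihom d m k F \<and> F v \<noteq> 0 \<and> nonvanishing d m F \<subseteq> U"
proof -
  have "generate_topology_on {{p \<in> proj_tuples d m. \<forall>v \<in> reps d m p. F v \<noteq> 0} | F. \<exists>k. multihom d m k F} U"
    using assms(1) unfolding zariski_def openin_topology_generated_by_iff .
  then show ?thesis using assms(3)
  proof (induction rule: generate_topology_on.induct)
    case (Int A B)
    obtain k F where F: "multihom d m k F" "F v \<noteq> 0" "nonvanishing d m F \<subseteq> A"
      using Int by blast
    obtain l G where G: "multihom d m l G" "G v \<noteq> 0" "nonvanishing d m G \<subseteq> B"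
      using Int by blast
    have "nonvanishing d m (\<lambda>v. F v * G v) \<subseteq> A \<inter> B"
      using F(3) G(3) by (auto simp: nonvanishing_def)
    then show ?case using multihom_mult[OF F(1) G(1)] F(2) G(2)
      by (intro exI[of _ "\<lambda>i. k i + l i"] exI[of _ "\<lambda>v. F v * G v"]) simp
  next
    case (UN K)
    then obtain A where A: "A \<in> K" "tuple_of m v \<in> A" by blast
    then obtain k F where "multihom d m k F" "F v \<noteq> 0" "nonvanishing d m F \<subseteq> A"
      using UN.IH[of A] by blast
    then show ?case using A(1) by blast
  next
    case (Basis S)
    then obtain F k where F: "multihom d m k F" "S = nonvanishing d m F"
      unfolding nonvanishing_def by blast
    then show ?case using tuple_of_in_nonvanishing[OF F(1) assms(2)] Basis.prems by blast
  qed simp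
qed

text \<open>If \<open>Q\<close> vanished at all rescalings of \<open>v\<close>, the values
  \<open>C k v\<close> would be the coefficients of a polynomial in the scaling factors that
  vanishes on the torus, so all of them would be zero.\<close>

lemma nonvanishing_component:
  assumes C: "\<And>k. multihom d m k (C k)" and K: "finite K" "\<And>k i. k \<in> K \<Longrightarrow> i \<ge> m \<Longrightarrow> k i = 0"
    and Q: "\<And>v. Q v = (\<Sum>k\<in>K. C k v)" and v: "nonzero_vecs d m v" and k: "k \<in> K" "C k v \<noteq> 0"
  shows "\<exists>t. (\<forall>i. t i \<noteq> 0) \<and> Q (\<lambda>i. t i \<cdot>\<^sub>v v i) \<noteq> 0"
proof (rule ccontr)
  assume *: "\<not> ?thesis"
  have "C k v = 0"
  proof (rule monomials_independent[where c = "\<lambda>k. C k v" and K = K and m = m])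
    fix t :: "nat \<Rightarrow> complex" assume t: "\<And>i. t i \<noteq> 0"
    have "(\<Sum>k\<in>K. C k (\<lambda>i. t i \<cdot>\<^sub>v v i)) = 0" using * t Q by auto
    moreover have "C k (\<lambda>i. t i \<cdot>\<^sub>v v i) = C k v * (\<Prod>i<m. t i ^ k i)" for k
      using multihom_scale[OF C[of k], of v t] v by (simp add: nonzero_vecs_def)
    ultimately show "(\<Sum>k\<in>K. C k v * (\<Prod>i<m. t i ^ k i)) = 0" by simp
  qed (fact K k(1))+
  with k(2) show False by contradiction
qed

text \<open>A polynomial need not be multihomogeneous: its multihomogeneous components detect the
  same orbits of the scaling torus.\<close>

lemma openin_zariski_polyfun:
  assumes S: "S \<subseteq> proj_tuples d m" and U: "U \<subseteq> S"
    and loc: "\<And>v. nonzero_vecs d m v \<Longrightarrow> tuple_of m v \<in> U \<Longrightarrow>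
      \<exists>Q. polyfun d m Q \<and> Q v \<noteq> 0 \<and>
        (\<forall>v'. nonzero_vecs d m v' \<longrightarrow> tuple_of m v' \<in> S \<longrightarrow> Q v' \<noteq> 0 \<longrightarrow> tuple_of m v' \<in> U)"
  shows "openin (subtopology (zariski d m) S) U"
proof (subst openin_subopen, intro ballI)
  fix p assume p: "p \<in> U"
  then have "p \<in> proj_tuples d m" using S U by blast
  then obtain v where v: "nonzero_vecs d m v" "p = tuple_of m v" by (rule proj_tuples_obtain)
  obtain Q where Q: "polyfun d m Q" "Q v \<noteq> 0"
    "\<And>v'. nonzero_vecs d m v' \<Longrightarrow> tuple_of m v' \<in> S \<Longrightarrow> Q v' \<noteq> 0 \<Longrightarrow> tuple_of m v' \<in> U"
    using loc[OF v(1)] p v(2) by auto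
  obtain K C where K: "finite K" "\<forall>k\<in>K. \<forall>i\<ge>m. k i = 0" "\<forall>k. multihom d m k (C k)"
      "\<forall>v. Q v = (\<Sum>k\<in>K. C k v)"
    using polyfun_decompose[OF Q(1)] by blast
  have "(\<Sum>k\<in>K. C k v) \<noteq> 0" using Q(2) K(4) by simp
  then obtain k where k: "k \<in> K" "C k v \<noteq> 0" using sum.not_neutral_contains_not_neutral by blast
  \<comment> \<open>A component that is nonzero at \<open>v\<close> takes over the role of
    \<open>Q\<close>.\<close>
  define T where "T = nonvanishing d m (C k) \<inter> S"
  have "openin (subtopology (zariski d m) S) T"
    unfolding T_def using K(3) by (intro openin_subtopology_Int openin_nonvanishing[of d m k]) simp
  moreover have "p \<in> T"
    using v(2) k(2) p U tuple_of_in_nonvanishing[OF K(3)[rule_format, of k] v(1)] by (auto simp: T_def)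
  moreover have "T \<subseteq> U"
  proof
    fix q assume q: "q \<in> T"
    then have "q \<in> proj_tuples d m" using S by (auto simp: T_def)
    then obtain v' where v': "nonzero_vecs d m v'" "q = tuple_of m v'" by (rule proj_tuples_obtain)
    have "C k v' \<noteq> 0"
      using q v'(2) tuple_of_in_nonvanishing[OF K(3)[rule_format, of k] v'(1)] by (simp add: T_def)
    \<comment> \<open>\<open>Q\<close> may vanish at \<open>v'\<close> itself, but not at a suitable
      rescaling, which represents the same tuple of points.\<close>
    then obtain t where t: "\<forall>i. t i \<noteq> 0" "Q (\<lambda>i. t i \<cdot>\<^sub>v v' i) \<noteq> 0"
      using nonvanishing_component[OF K(3)[rule_format] K(1) _ K(4)[rule_format] v'(1) k(1)] K(2) by blast
    have "tuple_of m (\<lambda>i. t i \<cdot>\<^sub>v v' i) = q" using t v' by (simp add: tuple_of_scale)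
    then show "q \<in> U"
      using Q(3)[OF nonzero_vecs_scale[OF v'(1)] _ t(2)] t(1) q by (auto simp: T_def)
  qed
  ultimately show "\<exists>T. openin (subtopology (zariski d m) S) T \<and> p \<in> T \<and> T \<subseteq> U" by blast
qed

text \<open>Over all rescalings of \<open>v'\<close> the value of \<open>f\<close> is constant, so
  the assumed equation is an identity of polynomials in the scaling factors; comparing coefficients
  gives \<open>f C = D\<close> in each multidegree. The form without division matters, since it also
  holds at those rescalings where \<open>Q\<close> vanishes.\<close>

lemma regular_on_polyfun:
  assumes U: "U \<subseteq> proj_tuples d m"
    and loc: "\<And>v. nonzero_vecs d m v \<Longrightarrow> tuple_of m v \<in> U \<Longrightarrow>
      \<exists>P Q. polyfun d m P \<and> polyfun d m Q \<and> Q v \<noteq> 0 \<and>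
        (\<forall>v'. nonzero_vecs d m v' \<longrightarrow> tuple_of m v' \<in> U \<longrightarrow> f (tuple_of m v') * Q v' = P v')"
  shows "f \<in> regular_on d m U"
  unfolding regular_on_def mem_Collect_eq
proof
  fix p assume p: "p \<in> U"
  then have "p \<in> proj_tuples d m" using U by blast
  then obtain v where v: "nonzero_vecs d m v" "p = tuple_of m v" by (rule proj_tuples_obtain)
  obtain P Q where PQ: "polyfun d m P" "polyfun d m Q" "Q v \<noteq> 0"
    "\<forall>v'. nonzero_vecs d m v' \<longrightarrow> tuple_of m v' \<in> U \<longrightarrow> f (tuple_of m v') * Q v' = P v'"
    using loc[OF v(1) p[unfolded v(2)]] by (elim exE conjE) (rule that)
  obtain K C where K: "finite K" "\<forall>k\<in>K. \<forall>i\<ge>m. k i = 0" "\<forall>k. multihom d m k (C k)"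
      "\<forall>k. k \<notin> K \<longrightarrow> C k = (\<lambda>_. 0)" "\<forall>v. Q v = (\<Sum>k\<in>K. C k v)"
    using polyfun_decompose[OF PQ(2)] by blast
  obtain L D where L: "finite L" "\<forall>k\<in>L. \<forall>i\<ge>m. k i = 0" "\<forall>k. multihom d m k (D k)"
      "\<forall>k. k \<notin> L \<longrightarrow> D k = (\<lambda>_. 0)" "\<forall>v. P v = (\<Sum>k\<in>L. D k v)"
    using polyfun_decompose[OF PQ(1)] by blast
  have Q: "Q v = (\<Sum>k\<in>K \<union> L. C k v)" for v
    unfolding K(5)[rule_format] by (rule sum.mono_neutral_left) (use K(1,4) L(1) in auto)
  have P: "P v = (\<Sum>k\<in>K \<union> L. D k v)" for v
    unfolding L(5)[rule_format] by (rule sum.mono_neutral_left) (use L(1,4) K(1) in auto)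
  have "(\<Sum>k\<in>K. C k v) \<noteq> 0" using PQ(3) K(5) by simp
  then obtain k where k: "k \<in> K" "C k v \<noteq> 0" using sum.not_neutral_contains_not_neutral by blast
  have eq: "f (tuple_of m v') * C k v' = D k v'"
    if v': "nonzero_vecs d m v'" "tuple_of m v' \<in> U" for v'
  proof -
    have "f (tuple_of m v') * C k v' - D k v' = 0"
    proof (rule monomials_independent[where K = "K \<union> L" and m = m
          and c = "\<lambda>k. f (tuple_of m v') * C k v' - D k v'"])
      fix t :: "nat \<Rightarrow> complex" assume t: "\<And>i. t i \<noteq> 0"
      let ?w = "\<lambda>i. t i \<cdot>\<^sub>v v' i"
      have w: "tuple_of m ?w = tuple_of m v'" "nonzero_vecs d m ?w"
        using t v' by (simp_all add: tuple_of_scale nonzero_vecs_scale)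
      have "f (tuple_of m v') * Q ?w = P ?w"
        using PQ(4)[rule_format, of ?w] w v' by simp
      moreover have "C k ?w = C k v' * (\<Prod>i<m. t i ^ k i)" "D k ?w = D k v' * (\<Prod>i<m. t i ^ k i)" for k
        using multihom_scale[of d m k "C k" v' t] multihom_scale[of d m k "D k" v' t] v' K(3) L(3)
        by (simp_all add: nonzero_vecs_def)
      ultimately show "(\<Sum>k\<in>K \<union> L. (f (tuple_of m v') * C k v' - D k v') * (\<Prod>i<m. t i ^ k i)) = 0"
        unfolding Q P by (simp add: left_diff_distrib sum_subtractf sum_distrib_left mult.assoc)
    next
      fix k' i assume "k' \<in> K \<union> L" "i \<ge> m"
      then show "k' i = 0" using K(2) L(2) by blast
    qed (use K(1) L(1) k(1) in auto)
    then show ?thesis by simp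
  qed
  show "\<exists>V k F G. openin (zariski d m) V \<and> p \<in> V \<and> multihom d m k F \<and> multihom d m k G \<and>
      (\<forall>q \<in> U \<inter> V. \<forall>v \<in> reps d m q. G v \<noteq> 0 \<and> f q = F v / G v)"
  proof (rule exI[of _ "nonvanishing d m (C k)"], rule exI[of _ k], rule exI[of _ "D k"],
      rule exI[of _ "C k"], intro conjI)
    show "openin (zariski d m) (nonvanishing d m (C k))" using openin_nonvanishing[OF K(3)[rule_format, of k]] .
    show "p \<in> nonvanishing d m (C k)" using tuple_of_in_nonvanishing[OF K(3)[rule_format, of k] v(1)] v(2) k(2) by simp
    show "multihom d m k (D k)" "multihom d m k (C k)" using K L by blast+
    show "\<forall>q\<in>U \<inter> nonvanishing d m (C k). \<forall>v\<in>reps d m q. C k v \<noteq> 0 \<and> f q = D k v / C k v"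
    proof (intro ballI)
      fix q v' assume q: "q \<in> U \<inter> nonvanishing d m (C k)" "v' \<in> reps d m q"
      then have "C k v' \<noteq> 0" by (auto simp: nonvanishing_def)
      moreover have "nonzero_vecs d m v'" "tuple_of m v' = q"
        using q U reps_iff[of q d m v'] by auto
      ultimately show "C k v' \<noteq> 0 \<and> f q = D k v' / C k v'"
        using eq[of v'] q(1) by (auto simp: field_simps)
    qed
  qed
qed

text \<open>The neighbourhood of the definition is shrunk to the non-vanishing locus of one
  polynomial \<open>H\<close>, so that locality becomes a polynomial condition that can be pulled
  back.\<close>

lemma regular_onD:
  assumes "f \<in> regular_on d m U" "nonzero_vecs d m v" "tuple_of m v \<in> U"
  obtains k F G l H where "multihom d m k F" "multihom d m k G" "multihom d m l H" "H v \<noteq> 0" "G v \<noteq> 0"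
    "\<And>v'. nonzero_vecs d m v' \<Longrightarrow> tuple_of m v' \<in> U \<Longrightarrow> H v' \<noteq> 0 \<Longrightarrow>
      G v' \<noteq> 0 \<and> f (tuple_of m v') = F v' / G v'"
proof -
  obtain V k F G where V: "openin (zariski d m) V" "tuple_of m v \<in> V" "multihom d m k F" "multihom d m k G"
      "\<forall>q \<in> U \<inter> V. \<forall>v \<in> reps d m q. G v \<noteq> 0 \<and> f q = F v / G v"
    using bspec[OF CollectD[OF assms(1)[unfolded regular_on_def]] assms(3)]
    by (elim exE conjE) (rule that)
  obtain l H where H: "multihom d m l H" "H v \<noteq> 0" "nonvanishing d m H \<subseteq> V"
    using zariski_neighbourhood[OF V(1) assms(2) V(2)] by blast
  have *: "G v' \<noteq> 0 \<and> f (tuple_of m v') = F v' / G v'"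
    if "nonzero_vecs d m v'" "tuple_of m v' \<in> U" "H v' \<noteq> 0" for v'
  proof -
    have "tuple_of m v' \<in> U \<inter> V" "v' \<in> reps d m (tuple_of m v')"
      using H(3) that tuple_of_in_nonvanishing[OF H(1) that(1)] reps_tuple_of[OF that(1)] by auto
    then show ?thesis using V(5) by blast
  qed
  show ?thesis using that[OF V(3,4) H(1,2) _ *] *[OF assms(2,3) H(2)] by blast
qed


section \<open>Stable tuples and explicit Gale duals\<close>

abbreviation coords :: "(nat \<Rightarrow> complex vec) \<Rightarrow> nat \<Rightarrow> nat \<Rightarrow> complex" where
  "coords v \<equiv> (\<lambda>i. vec_index (v i))"

text \<open>Equal vectors at two indices satisfy the relation with coefficients 1 and -1. This
  permits the passage from families to sets of vectors.\<close>

lemma indep_imp_inj_on: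
  assumes "indep d (coords v) J" "finite J"
  shows "inj_on v J"
proof (rule inj_onI, rule ccontr)
  fix j k assume jk: "j \<in> J" "k \<in> J" "v j = v k" "j \<noteq> k"
  define c where "c = (\<lambda>i. if i = j then 1 else if i = k then - 1 else (0::complex))"
  have "(\<Sum>i\<in>J. c i * v i $ a) = 0" for a
  proof -
    have "(\<Sum>i\<in>J. c i * v i $ a) = (\<Sum>i\<in>{j, k}. c i * v i $ a)"
      using jk assms(2) by (intro sum.mono_neutral_right) (auto simp: c_def)
    also have "\<dots> = c j * v j $ a + c k * v k $ a" using jk(4) by simp
    also have "\<dots> = 0" unfolding jk(3) using jk(4) by (simp add: c_def)
    finally show ?thesis .
  qed
  then have "c j = 0" using indepD[OF assms(1), of c j] jk(1) by blast
  moreover have "c j = 1" by (simp add: c_def)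
  ultimately show False by simp
qed

lemma lin_indpt_image_iff:
  assumes "inj_on v J" "finite J" "\<And>j. j \<in> J \<Longrightarrow> v j \<in> carrier_vec d"
  shows "module.lin_indpt class_ring (module_vec TYPE(complex) d) (v ` J) \<longleftrightarrow> indep d (coords v) J"
proof -
  interpret vec_space "TYPE(complex)" d .
  have sub: "v ` J \<subseteq> carrier_vec d" using assms by auto
  have lc: "lincomb x (v ` J) $ a = (\<Sum>j\<in>J. x (v j) * v j $ a)" if "a < d" for x a
    using lincomb_index[OF that sub] assms(1) by (simp add: sum.reindex)
  have dim: "dim_vec (lincomb x (v ` J)) = d" for x
    by (rule lincomb_dim[OF _ sub]) (use assms in simp)
  show ?thesis
  proof
    assume li: "lin_indpt (v ` J)"
    show "indep d (coords v) J"
      unfolding indep_def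
    proof (intro allI impI ballI, rule ccontr)
      fix c j assume c: "\<forall>a<d. (\<Sum>j\<in>J. c j * v j $ a) = 0" and j: "j \<in> J" "c j \<noteq> 0"
      define x where "x = (\<lambda>u. c (inv_into J v u))"
      have x: "x (v j) = c j" if "j \<in> J" for j
        using that assms(1) by (simp add: x_def)
      have "lincomb x (v ` J) = 0\<^sub>v d"
        by (rule eq_vecI) (use lc[of _ x] x c dim in \<open>auto cong: sum.cong\<close>)
      then have "lin_dep (v ` J)"
        by (intro lin_dep_crit[where A = "v ` J" and a = x and v = "v j"]) (use assms j x in auto)
      with li show False by simp
    qed
  next
    assume ind: "indep d (coords v) J"
    show "lin_indpt (v ` J)"
    proof (rule finite_lin_indpt2)
      fix x assume x: "lincomb x (v ` J) = 0\<^sub>v d"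
      have "(\<Sum>j\<in>J. x (v j) * v j $ a) = 0" if "a < d" for a
        using lc[OF that, of x] x that by simp
      then have "x (v j) = 0" if "j \<in> J" for j
        using indepD[OF ind, of "\<lambda>j. x (v j)" j] that by blast
      then show "\<forall>u\<in>v ` J. x u = 0" by simp
    qed (use assms sub in auto)
  qed
qed

text \<open>The lines have the same span as the chosen vectors, and its dimension is the size of any
  maximal independent subset. Together the two statements identify it as the largest size of an
  independent subfamily.\<close>

lemma span_dim_lines:
  assumes "finite I" "\<And>i. i \<in> I \<Longrightarrow> v i \<in> carrier_vec d"
  shows "\<exists>J\<subseteq>I. indep d (coords v) J \<and> card J = vec_space.span_dim d (\<Union>i\<in>I. line (v i))"
    and "J \<subseteq> I \<Longrightarrow> indep d (coords v) J \<Longrightarrow> card J \<le> vec_space.span_dim d (\<Union>i\<in>I. line (v i))"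
proof -
  interpret vec_space "TYPE(complex)" d .
  have sub: "v ` I \<subseteq> carrier_vec d" using assms by auto
  have lines: "(\<Union>i\<in>I. line (v i)) \<subseteq> carrier_vec d" using assms(2) by (auto simp: line_def)
  have "span (\<Union>i\<in>I. line (v i)) = span (v ` I)"
  proof
    have sm: "submodule class_ring (span (v ` I)) V" by (rule span_is_submodule) (use sub in simp)
    have "(\<Union>i\<in>I. line (v i)) \<subseteq> span (v ` I)"
    proof
      fix u assume "u \<in> (\<Union>i\<in>I. line (v i))"
      then obtain i c where i: "i \<in> I" "u = c \<cdot>\<^sub>v v i" by (auto simp: line_def)
      have "v i \<in> span (v ` I)" using in_own_span[of "v ` I"] sub i(1) by auto
      then show "u \<in> span (v ` I)" using submodule.smult_closed[OF sm, of c "v i"] i(2) by simp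
    qed
    then show "span (\<Union>i\<in>I. line (v i)) \<subseteq> span (v ` I)" by (rule span_is_subset[OF _ sm])
    show "span (v ` I) \<subseteq> span (\<Union>i\<in>I. line (v i))"
      by (rule span_is_monotone) (auto simp: self_in_line)
  qed
  then have eq: "span_dim (\<Union>i\<in>I. line (v i)) = vectorspace.dim class_ring (span_vs (v ` I))"
    by (simp add: span_dim_def)
  let ?P = "\<lambda>T. T \<subseteq> v ` I \<and> lin_indpt T"
  have dim: "span_dim (\<Union>i\<in>I. line (v i)) = card U" if "maximal U ?P" for U
    unfolding eq by (rule dim_span) (use sub assms(1) that in auto)
  have max: "\<exists>U. finite U \<and> maximal U ?P \<and> T \<subseteq> U" if "?P T" for T
    by (rule maximal_exists_superset[of "v ` I"]) (use assms(1) that in auto)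
  have "?P {}" using finite_lin_indpt2[of "{}"] by auto
  then obtain U where U: "maximal U ?P" using max[of "{}"] by blast
  then have "U \<subseteq> v ` I" "lin_indpt U" by (auto simp: maximal_def)
  then obtain B where B: "B \<subseteq> I" "inj_on v B" "U = v ` B" by (auto simp: subset_image_inj)
  have "indep d (coords v) B"
    using lin_indpt_image_iff[OF B(2), of d] B \<open>lin_indpt U\<close> assms finite_subset[OF B(1)] by auto
  moreover have "card B = span_dim (\<Union>i\<in>I. line (v i))"
    using dim[OF U] B by (simp add: card_image)
  ultimately show "\<exists>J\<subseteq>I. indep d (coords v) J \<and> card J = span_dim (\<Union>i\<in>I. line (v i))"
    using B(1) by blast
  assume J: "J \<subseteq> I" "indep d (coords v) J"
  have fin: "finite J" using finite_subset[OF J(1) assms(1)] .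
  have inj: "inj_on v J" by (rule indep_imp_inj_on[OF J(2) fin])
  have "lin_indpt (v ` J)"
    using lin_indpt_image_iff[OF inj fin, of d] J assms(2) by auto
  then obtain W where W: "finite W" "maximal W ?P" "v ` J \<subseteq> W"
    using max[of "v ` J"] J(1) by blast
  have "card J = card (v ` J)" using inj by (simp add: card_image)
  also have "\<dots> \<le> card W" by (rule card_mono[OF W(1,3)])
  finally show "card J \<le> span_dim (\<Union>i\<in>I. line (v i))" using dim[OF W(2)] by simp
qed

text \<open>The \<open>-1\<close> of the projective dimension cancels on both sides and
  \<open>m > 0\<close> clears the denominator; the rank left over is then witnessed by an
  independent subset.\<close>

lemma semistable_tuple_of:
  assumes v: "nonzero_vecs d m v" and m: "0 < m"
  shows "semistable d m (tuple_of m v) \<longleftrightarrow> stable_tuple d m (coords v)"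
proof -
  have "real_of_int (proj_span_dim d (tuple_of m v ` I)) \<ge> real d / real m * real (card I) - 1 \<longleftrightarrow>
      (\<exists>J\<subseteq>I. indep d (coords v) J \<and> d * card I \<le> m * card J)" if I: "I \<subset> {..<m}" for I
  proof -
    let ?r = "vec_space.span_dim d (\<Union>i\<in>I. line (v i))"
    have fin: "finite I" using I finite_subset[of I "{..<m}"] by auto
    have car: "v i \<in> carrier_vec d" if "i \<in> I" for i
      using that I v by (auto simp: nonzero_vecs_def)
    have "\<Union> (tuple_of m v ` I) = (\<Union>i\<in>I. line (v i))"
      using I by (auto simp: tuple_of_def)
    then have "real_of_int (proj_span_dim d (tuple_of m v ` I)) \<ge> real d / real m * real (card I) - 1 \<longleftrightarrow>
        real (d * card I) \<le> real (m * ?r)"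
      using m by (simp add: proj_span_dim_def field_simps)
    also have "\<dots> \<longleftrightarrow> d * card I \<le> m * ?r" by (rule of_nat_le_iff)
    also have "\<dots> \<longleftrightarrow> (\<exists>J\<subseteq>I. indep d (coords v) J \<and> d * card I \<le> m * card J)"
    proof
      assume "d * card I \<le> m * ?r"
      then show "\<exists>J\<subseteq>I. indep d (coords v) J \<and> d * card I \<le> m * card J"
        using span_dim_lines(1)[of I v d, OF fin car] by auto
    next
      assume "\<exists>J\<subseteq>I. indep d (coords v) J \<and> d * card I \<le> m * card J"
      then obtain J where J: "J \<subseteq> I" "indep d (coords v) J" "d * card I \<le> m * card J" by blast
      have "m * card J \<le> m * ?r"
        using span_dim_lines(2)[of I v d J, OF fin car J(1,2)] by (rule mult_le_mono2)
      with J(3) show "d * card I \<le> m * ?r" by (rule order_trans)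
    qed
    finally show ?thesis .
  qed
  then show ?thesis unfolding semistable_def stable_tuple_def by blast
qed

text \<open>The left inverse \<open>h\<close> carries a relation among the images back to one among
  the \<open>v j\<close>.\<close>

lemma indep_matrix_mult:
  assumes g: "g \<in> carrier_mat d d" "h \<in> carrier_mat d d" "h * g = 1\<^sub>m d"
    and v: "\<And>j. j \<in> J \<Longrightarrow> v j \<in> carrier_vec d" and ind: "indep d (coords v) J"
  shows "indep d (coords (\<lambda>i. g *\<^sub>v v i)) J"
  unfolding indep_def
proof (intro allI impI)
  fix c assume c: "\<forall>a<d. (\<Sum>j\<in>J. c j * (g *\<^sub>v v j) $ a) = 0"
  have "(\<Sum>j\<in>J. c j * v j $ a) = 0" if a: "a < d" for a
  proof -
    have "v j $ a = (\<Sum>b<d. h $$ (a, b) * (g *\<^sub>v v j) $ b)" if j: "j \<in> J" for j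
    proof -
      have "v j = h *\<^sub>v (g *\<^sub>v v j)"
        using assoc_mult_mat_vec[OF g(2,1) v[OF j]] g(3) v[OF j] by simp
      then have "v j $ a = (h *\<^sub>v (g *\<^sub>v v j)) $ a" by simp
      also have "\<dots> = (\<Sum>b<d. h $$ (a, b) * (g *\<^sub>v v j) $ b)"
        using a g by (simp add: scalar_prod_def lessThan_atLeast0)
      finally show ?thesis .
    qed
    then have "(\<Sum>j\<in>J. c j * v j $ a) = (\<Sum>j\<in>J. \<Sum>b<d. h $$ (a, b) * (c j * (g *\<^sub>v v j) $ b))"
      by (simp add: sum_distrib_left mult_ac)
    also have "\<dots> = (\<Sum>b<d. h $$ (a, b) * (\<Sum>j\<in>J. c j * (g *\<^sub>v v j) $ b))"
      by (subst sum.swap) (simp add: sum_distrib_left)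
    finally show ?thesis using c by simp
  qed
  then show "\<forall>j\<in>J. c j = 0" using indepD[OF ind, of c] by blast
qed

text \<open>Homogeneous coordinates of a point of the semistable locus.\<close>

definition config :: "nat \<Rightarrow> nat \<Rightarrow> (nat \<Rightarrow> complex vec) \<Rightarrow> bool" where
  "config d m v \<longleftrightarrow> nonzero_vecs d m v \<and> stable_tuple d m (coords v)"

definition semistable_tuples :: "nat \<Rightarrow> nat \<Rightarrow> point_tuple set" where
  "semistable_tuples d m = {p \<in> proj_tuples d m. semistable d m p}"

lemma semistable_tuples_subset: "semistable_tuples d m \<subseteq> proj_tuples d m"
  by (auto simp: semistable_tuples_def)

lemma tuple_of_in_semistable_tuples:
  assumes "nonzero_vecs d m v" "0 < m"
  shows "tuple_of m v \<in> semistable_tuples d m \<longleftrightarrow> config d m v"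
  using assms semistable_tuple_of[OF assms] tuple_of_in_proj_tuples[OF assms(1)]
  by (simp add: semistable_tuples_def config_def)

lemma semistable_tuples_obtain:
  assumes "p \<in> semistable_tuples d m" "0 < m"
  obtains v where "config d m v" "p = tuple_of m v"
proof -
  have "p \<in> proj_tuples d m" using assms(1) by (simp add: semistable_tuples_def)
  then obtain v where v: "nonzero_vecs d m v" "p = tuple_of m v" by (rule proj_tuples_obtain)
  then have "config d m v" using tuple_of_in_semistable_tuples[OF v(1) assms(2)] assms(1) by simp
  then show ?thesis using v(2) by (rule that)
qed

text \<open>As \<open>1 < m\<close>, a singleton is a proper subset, and stability gives it positive
  rank.\<close>

lemma stable_imp_nonzero_vecs:
  assumes st: "stable_tuple d m (coords v)" and v: "\<And>i. i < m \<Longrightarrow> v i \<in> carrier_vec d"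
    and m: "0 < d" "d < m"
  shows "nonzero_vecs d m v"
  unfolding nonzero_vecs_def
proof (intro allI impI conjI)
  fix i assume i: "i < m"
  show "v i \<in> carrier_vec d" by (rule v[OF i])
  have "{i} \<noteq> {..<m}"
  proof
    assume "{i} = {..<m}"
    then have "card {..<m} = 1" by (metis card_1_singleton_iff One_nat_def)
    then show False using m by simp
  qed
  then have "{i} \<noteq> {} \<and> {i} \<subset> {..<m}" using i by auto
  then obtain J where J: "J \<subseteq> {i}" "indep d (coords v) J" "d * card {i} \<le> m * card J"
    using st unfolding stable_tuple_def by meson
  then have "J \<noteq> {}" using m by auto
  then have ind: "indep d (coords v) {i}" using J(1,2) by (metis subset_singletonD)
  show "v i \<noteq> 0\<^sub>v d"
  proof
    assume "v i = 0\<^sub>v d"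
    then have "(1::complex) = 0" using indepD[OF ind, of "\<lambda>_. 1" i] by simp
    then show False by simp
  qed
qed

lemma config_scale:
  assumes "config d m v" "\<And>i. i < m \<Longrightarrow> t i \<noteq> 0" "0 < m"
  shows "config d m (\<lambda>i. t i \<cdot>\<^sub>v v i)"
proof -
  have v: "nonzero_vecs d m v" using assms(1) by (simp add: config_def)
  have t: "nonzero_vecs d m (\<lambda>i. t i \<cdot>\<^sub>v v i)" by (rule nonzero_vecs_scale[OF v assms(2)])
  show ?thesis
    using tuple_of_in_semistable_tuples[OF t assms(3)] tuple_of_in_semistable_tuples[OF v assms(3)]
      tuple_of_scale[of m t v] assms(1,2) by simp
qed

lemma config_matrix_mult:
  assumes v: "config d m v" and g: "g \<in> carrier_mat d d" "invertible_mat g" and m: "0 < d" "d < m"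
  shows "config d m (\<lambda>i. g *\<^sub>v v i)"
proof -
  obtain h where h: "g * h = 1\<^sub>m (dim_row g)" "h * g = 1\<^sub>m (dim_row h)"
    using g(2) unfolding invertible_mat_def inverts_mat_def by blast
  \<comment> \<open>The size of the inverse is read off from the two products.\<close>
  have "dim_col (g * h) = d" using h(1) g(1) by simp
  moreover have "dim_col (h * g) = dim_row h" using h(2) by simp
  ultimately have h': "h \<in> carrier_mat d d" using g(1) by auto
  then have hg: "h * g = 1\<^sub>m d" using h(2) by simp
  have car: "v i \<in> carrier_vec d" if "i < m" for i
    using v that by (simp add: config_def nonzero_vecs_def)
  have "stable_tuple d m (coords (\<lambda>i. g *\<^sub>v v i))"
    unfolding stable_tuple_def
  proof (intro allI impI)
    fix I :: "nat set" assume I: "I \<noteq> {} \<and> I \<subset> {..<m}"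
    then obtain J where J: "J \<subseteq> I" "indep d (coords v) J" "d * card I \<le> m * card J"
      using v unfolding config_def stable_tuple_def by meson
    have "indep d (coords (\<lambda>i. g *\<^sub>v v i)) J"
      by (rule indep_matrix_mult[OF g(1) h' hg _ J(2)]) (use J(1) I car in auto)
    then show "\<exists>J\<subseteq>I. indep d (coords (\<lambda>i. g *\<^sub>v v i)) J \<and> d * card I \<le> m * card J"
      using J by blast
  qed
  moreover have "nonzero_vecs d m (\<lambda>i. g *\<^sub>v v i)"
    by (rule stable_imp_nonzero_vecs[OF calculation _ m]) (use g car in auto)
  ultimately show ?thesis by (simp add: config_def)
qed

section \<open>Explicit Gale duals\<close>

definition basis_matrix :: "nat \<Rightarrow> (nat \<Rightarrow> nat) \<Rightarrow> (nat \<Rightarrow> complex vec) \<Rightarrow> complex mat" where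
  "basis_matrix d e v = mat d d (\<lambda>(a, l). v (e l) $ a)"

text \<open>For \<open>J = e ` {..<d}\<close> and complement \<open>e' ` {..<n}\<close>, this is a basis of the linear relations
  among the vectors \<open>v i\<close>, written as the rows of an \<open>n \<times> m\<close> matrix. By Cramer's rule, denominators
  are avoided.\<close>

definition gale_dual ::
  "nat \<Rightarrow> nat \<Rightarrow> (nat \<Rightarrow> nat) \<Rightarrow> (nat \<Rightarrow> nat) \<Rightarrow> (nat \<Rightarrow> complex vec) \<Rightarrow> nat \<Rightarrow> complex vec" where
  "gale_dual d n e e' v i = vec n (\<lambda>b.
     if i \<in> e ` {..<d}
     then - (\<Sum>k<d. cofactor (basis_matrix d e v) k (inv_into {..<d} e i) * v (e' b) $ k)
     else if i = e' b then Determinant.det (basis_matrix d e v) else 0)"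

text \<open>With \<open>A\<close> the chosen square submatrix, row \<open>b\<close> contributes
  \<open>det A\<close> times column \<open>e' b\<close> off the chosen columns, and minus
  \<open>A adj A\<close> applied to that column on them. These cancel because \<open>A adj A\<close>
  is \<open>det A\<close> times the identity.\<close>

lemma gale_dual_gale:
  assumes m: "m = d + n" and e: "inj_on e {..<d}" "e ` {..<d} \<subseteq> {..<m}"
    and e': "bij_betw e' {..<n} ({..<m} - e ` {..<d})"
  shows "gale d n m (coords v) (coords (gale_dual d n e e' v))"
  unfolding gale_def
proof (intro allI impI)
  fix a b assume a: "a < d" and b: "b < n"
  let ?A = "basis_matrix d e v" and ?w = "gale_dual d n e e' v"
  let ?J = "e ` {..<d}"
  have A: "?A \<in> carrier_mat d d" by (simp add: basis_matrix_def)
  have e'b: "e' b \<in> {..<m} - ?J" using e' b by (auto simp: bij_betw_def)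
  have adj: "(\<Sum>l<d. ?A $$ (a, l) * cofactor ?A k l) = (if a = k then Determinant.det ?A else 0)"
    if k: "k < d" for k
  proof -
    have "(?A * adj_mat ?A) $$ (a, k) = (\<Sum>l<d. ?A $$ (a, l) * cofactor ?A k l)"
      using A adj_mat(1)[OF A] a k by (simp add: scalar_prod_def adj_mat_def lessThan_atLeast0)
    moreover have "(?A * adj_mat ?A) $$ (a, k) = (if a = k then Determinant.det ?A else 0)"
      using adj_mat(2)[OF A] a k by simp
    ultimately show ?thesis by simp
  qed
  have "(\<Sum>i<m. v i $ a * ?w i $ b) = (\<Sum>i\<in>?J. v i $ a * ?w i $ b) + (\<Sum>i\<in>{..<m} - ?J. v i $ a * ?w i $ b)"
    using e(2) by (subst sum.subset_diff[of ?J "{..<m}"]) (auto simp: add.commute)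
  also have "(\<Sum>i\<in>{..<m} - ?J. v i $ a * ?w i $ b) = (\<Sum>i\<in>{..<m} - ?J. if i = e' b then v i $ a * Determinant.det ?A else 0)"
    using b by (intro sum.cong) (auto simp: gale_dual_def)
  also have "\<dots> = v (e' b) $ a * Determinant.det ?A" using e'b by simp
  also have "(\<Sum>i\<in>?J. v i $ a * ?w i $ b) = (\<Sum>l<d. ?A $$ (a, l) * - (\<Sum>k<d. cofactor ?A k l * v (e' b) $ k))"
    using b a e(1) by (simp add: sum.reindex gale_dual_def basis_matrix_def)
  also have "\<dots> = - (\<Sum>l<d. \<Sum>k<d. v (e' b) $ k * (?A $$ (a, l) * cofactor ?A k l))"
    by (simp add: sum_negf sum_distrib_left mult_ac)
  also have "\<dots> = - (\<Sum>k<d. v (e' b) $ k * (\<Sum>l<d. ?A $$ (a, l) * cofactor ?A k l))"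
    by (subst sum.swap) (simp add: sum_distrib_left)
  also have "(\<Sum>k<d. v (e' b) $ k * (\<Sum>l<d. ?A $$ (a, l) * cofactor ?A k l)) =
      (\<Sum>k<d. if a = k then v (e' b) $ k * Determinant.det ?A else 0)"
    by (intro sum.cong) (auto simp: adj)
  also have "\<dots> = v (e' b) $ a * Determinant.det ?A" using a by simp
  finally show "(\<Sum>i<m. v i $ a * ?w i $ b) = 0" by simp
qed

text \<open>Off the chosen columns the vectors of the dual are the unit vectors multiplied by the
  determinant.\<close>

lemma gale_dual_basis:
  assumes e': "bij_betw e' {..<n} ({..<m} - e ` {..<d})"
    and det: "Determinant.det (basis_matrix d e v) \<noteq> 0"
  shows "basis_of n (coords (gale_dual d n e e' v)) ({..<m} - e ` {..<d})"
proof -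
  let ?w = "gale_dual d n e e' v" and ?I = "{..<m} - e ` {..<d}"
  have "indep n (coords ?w) ?I"
    unfolding indep_def
  proof (intro allI impI ballI)
    fix c i assume c: "\<forall>b<n. (\<Sum>i\<in>?I. c i * ?w i $ b) = 0" and i: "i \<in> ?I"
    have "i \<in> e' ` {..<n}" using e' i by (simp add: bij_betw_def)
    then obtain b where b: "b < n" "i = e' b" by auto
    have "(\<Sum>l\<in>?I. c l * ?w l $ b) = (\<Sum>l\<in>?I. if l = i then c l * Determinant.det (basis_matrix d e v) else 0)"
      using b by (intro sum.cong) (auto simp: gale_dual_def)
    also have "\<dots> = c i * Determinant.det (basis_matrix d e v)" using i by simp
    finally show "c i = 0" using c b(1) det by simp
  qed
  moreover have "card ?I = n" using bij_betw_same_card[OF e'] by simp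
  ultimately show ?thesis by (simp add: basis_of_def)
qed

lemma det_basis_matrix:
  assumes e: "inj_on e {..<d}" and ind: "indep d (coords v) (e ` {..<d})"
  shows "Determinant.det (basis_matrix d e v) \<noteq> 0"
proof
  let ?A = "basis_matrix d e v"
  have A: "?A \<in> carrier_mat d d" by (simp add: basis_matrix_def)
  assume "Determinant.det ?A = 0"
  then obtain x where x: "x \<in> carrier_vec d" "x \<noteq> 0\<^sub>v d" "?A *\<^sub>v x = 0\<^sub>v d"
    using det_0_iff_vec_prod_zero[OF A] by blast
  define c where "c = (\<lambda>i. x $ (inv_into {..<d} e i))"
  have "(\<Sum>j\<in>e ` {..<d}. c j * v j $ a) = 0" if a: "a < d" for a
  proof -
    have "(\<Sum>j\<in>e ` {..<d}. c j * v j $ a) = (\<Sum>l<d. ?A $$ (a, l) * x $ l)"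
      using e a by (simp add: sum.reindex c_def basis_matrix_def mult.commute)
    also have "\<dots> = (?A *\<^sub>v x) $ a"
      using a A x(1) by (simp add: scalar_prod_def lessThan_atLeast0)
    finally show ?thesis using x(3) a by simp
  qed
  then have c: "c j = 0" if "j \<in> e ` {..<d}" for j
    using indepD[OF ind, of c j] that by blast
  have "x = 0\<^sub>v d"
  proof (rule eq_vecI)
    fix l assume l: "l < dim_vec (0\<^sub>v d :: complex vec)"
    then have "c (e l) = 0" using c by simp
    then show "x $ l = 0\<^sub>v d $ l" using e l by (simp add: c_def)
  qed (use x in simp)
  with x(2) show False by contradiction
qed

lemma polyfun_det_basis_matrix:
  assumes "e ` {..<d} \<subseteq> {..<m}"
  shows "polyfun d m (\<lambda>v. Determinant.det (basis_matrix d e v))"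
  unfolding basis_matrix_def
  by (rule polyfun_det, rule polyfun_coord) (use assms in auto)

lemma polyfun_gale_dual:
  assumes e: "e ` {..<d} \<subseteq> {..<m}" and e': "e' ` {..<n} \<subseteq> {..<m}" and b: "b < n"
  shows "polyfun d m (\<lambda>v. gale_dual d n e e' v i $ b)"
proof -
  have em: "e l < m" if "l < d" for l using e that by auto
  have cof: "polyfun d m (\<lambda>v. cofactor (basis_matrix d e v) k l)" if kl: "k < d" "l < d" for k l
  proof -
    have "mat_delete (basis_matrix d e v) k l = mat (d - 1) (d - 1)
        (\<lambda>(a, j). v (e (if j < l then j else Suc j)) $ (if a < k then a else Suc a))" for v
      by (rule eq_matI) (auto simp: mat_delete_def basis_matrix_def)
    moreover have "polyfun d m (\<lambda>v. Determinant.det (mat (d - 1) (d - 1)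
        (\<lambda>(a, j). v (e (if j < l then j else Suc j)) $ (if a < k then a else Suc a))))"
      by (rule polyfun_det, rule polyfun_coord) (use em kl in auto)
    ultimately show ?thesis
      unfolding cofactor_def by (simp add: polyfun_mult polyfun_const)
  qed
  consider (J) "i \<in> e ` {..<d}" | (I) "i \<notin> e ` {..<d}" "i = e' b" | (Z) "i \<notin> e ` {..<d}" "i \<noteq> e' b"
    by blast
  then show ?thesis
  proof cases
    case J
    then have "inv_into {..<d} e i < d" using inv_into_into[of i e "{..<d}"] by simp
    then have "polyfun d m (\<lambda>v. - (\<Sum>k<d. cofactor (basis_matrix d e v) k (inv_into {..<d} e i) * v (e' b) $ k))"
      using e' b by (intro polyfun_uminus polyfun_sum polyfun_mult cof polyfun_coord) auto
    then show ?thesis using J b by (simp add: gale_dual_def)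
  next
    case I
    then show ?thesis using b polyfun_det_basis_matrix[OF e] by (simp add: gale_dual_def)
  next
    case Z
    then show ?thesis using b by (simp add: gale_dual_def polyfun_const)
  qed
qed


section \<open>Orbits and the Gale relation\<close>

text \<open>Rescaling single points can destroy the matrix equation, so representatives are
  quantified existentially to obtain a relation between tuples of points.\<close>

definition gale_related :: "nat \<Rightarrow> nat \<Rightarrow> nat \<Rightarrow> point_tuple \<Rightarrow> point_tuple \<Rightarrow> bool" where
  "gale_related d n m p q \<longleftrightarrow>
     (\<exists>v w. v \<in> reps d m p \<and> w \<in> reps n m q \<and> gale d n m (coords v) (coords w))"

lemma gale_related_sym: "gale_related d n m p q \<longleftrightarrow> gale_related n d m q p"
  unfolding gale_related_def using gale_sym by blast

lemma gale_scale_left: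
  assumes "\<And>i. i < m \<Longrightarrow> v i \<in> carrier_vec d"
  shows "gale d n m (coords (\<lambda>i. t i \<cdot>\<^sub>v v i)) (coords w) \<longleftrightarrow>
    (\<forall>a<d. \<forall>b<n. (\<Sum>i<m. t i * (v i $ a * w i $ b)) = 0)"
proof -
  have "(\<Sum>i<m. (t i \<cdot>\<^sub>v v i) $ a * w i $ b) = (\<Sum>i<m. t i * (v i $ a * w i $ b))" if "a < d" for a b
  proof (rule sum.cong[OF refl])
    fix i assume "i \<in> {..<m}"
    then have "dim_vec (v i) = d" using assms by auto
    then show "(t i \<cdot>\<^sub>v v i) $ a * w i $ b = t i * (v i $ a * w i $ b)" using that by simp
  qed
  then show ?thesis by (simp add: gale_def)
qed

text \<open>Only the products of the scaling factors of \<open>v i\<close> and \<open>w i\<close>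
  enter the equation, so all of the scaling can be moved to \<open>v\<close> while \<open>w\<close>
  stays fixed.\<close>

lemma gale_related_iff:
  assumes v: "nonzero_vecs d m v" and w: "nonzero_vecs n m w"
  shows "gale_related d n m (tuple_of m v) (tuple_of m w) \<longleftrightarrow>
    (\<exists>t. (\<forall>i. t i \<noteq> 0) \<and> gale d n m (coords (\<lambda>i. t i \<cdot>\<^sub>v v i)) (coords w))"
proof
  assume "gale_related d n m (tuple_of m v) (tuple_of m w)"
  then obtain v' w' where *: "nonzero_vecs d m v'" "tuple_of m v' = tuple_of m v"
      "nonzero_vecs n m w'" "tuple_of m w' = tuple_of m w" and g: "gale d n m (coords v') (coords w')"
    unfolding gale_related_def reps_tuple_of[OF v] reps_tuple_of[OF w] by blast
  obtain s where s: "\<And>i. s i \<noteq> 0" "\<And>i. i < m \<Longrightarrow> v' i = s i \<cdot>\<^sub>v v i"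
    using tuple_of_eqD[OF *(2)[symmetric] *(1)] by blast
  obtain r where r: "\<And>i. r i \<noteq> 0" "\<And>i. i < m \<Longrightarrow> w' i = r i \<cdot>\<^sub>v w i"
    using tuple_of_eqD[OF *(4)[symmetric] *(3)] by blast
  have "(\<Sum>i<m. s i * r i * (v i $ a * w i $ b)) = 0" if ab: "a < d" "b < n" for a b
  proof -
    have "(\<Sum>i<m. s i * r i * (v i $ a * w i $ b)) = (\<Sum>i<m. v' i $ a * w' i $ b)"
    proof (rule sum.cong[OF refl])
      fix i assume "i \<in> {..<m}"
      then have "v' i $ a = s i * v i $ a" "w' i $ b = r i * w i $ b"
        using s(2) r(2) v w ab by (auto simp: nonzero_vecs_def)
      then show "s i * r i * (v i $ a * w i $ b) = v' i $ a * w' i $ b" by simp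
    qed
    then show ?thesis using g ab by (simp add: gale_def)
  qed
  then have "gale d n m (coords (\<lambda>i. (s i * r i) \<cdot>\<^sub>v v i)) (coords w)"
    using v by (subst gale_scale_left) (auto simp: nonzero_vecs_def)
  then show "\<exists>t. (\<forall>i. t i \<noteq> 0) \<and> gale d n m (coords (\<lambda>i. t i \<cdot>\<^sub>v v i)) (coords w)"
    using s(1) r(1) by (intro exI[of _ "\<lambda>i. s i * r i"]) simp
next
  assume "\<exists>t. (\<forall>i. t i \<noteq> 0) \<and> gale d n m (coords (\<lambda>i. t i \<cdot>\<^sub>v v i)) (coords w)"
  then obtain t where t: "\<forall>i. t i \<noteq> 0" "gale d n m (coords (\<lambda>i. t i \<cdot>\<^sub>v v i)) (coords w)" by blast
  have "(\<lambda>i. t i \<cdot>\<^sub>v v i) \<in> reps d m (tuple_of m v)"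
    using t(1) v by (simp add: reps_tuple_of nonzero_vecs_scale tuple_of_scale)
  moreover have "w \<in> reps n m (tuple_of m w)" using w by (simp add: reps_tuple_of)
  ultimately show "gale_related d n m (tuple_of m v) (tuple_of m w)"
    unfolding gale_related_def using t(2) by (intro exI conjI)
qed

lemma gale_imp_related:
  assumes "nonzero_vecs d m v" "nonzero_vecs n m w" "gale d n m (coords v) (coords w)"
  shows "gale_related d n m (tuple_of m v) (tuple_of m w)"
proof -
  have "v \<in> reps d m (tuple_of m v)" "w \<in> reps n m (tuple_of m w)"
    using assms by (simp_all add: reps_tuple_of)
  then show ?thesis unfolding gale_related_def using assms(3) by blast
qed

lemma mult_mat_vec_index:
  assumes "g \<in> carrier_mat d n" "u \<in> carrier_vec n" "a < d"
  shows "(g *\<^sub>v u) $ a = (\<Sum>k<n. g $$ (a, k) * u $ k)"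
  using assms by (simp add: scalar_prod_def lessThan_atLeast0)

lemma diagonal_action_tuple_of:
  assumes g: "g \<in> carrier_mat d d" and v: "nonzero_vecs d m v"
  shows "(\<lambda>i\<in>{..<m}. restrict (\<lambda>L. (\<lambda>u. g *\<^sub>v u) ` L) (proj_space d) (tuple_of m v i)) =
    tuple_of m (\<lambda>i. g *\<^sub>v v i)"
proof (rule ext)
  fix i
  show "(\<lambda>i\<in>{..<m}. restrict (\<lambda>L. (\<lambda>u. g *\<^sub>v u) ` L) (proj_space d) (tuple_of m v i)) i =
      tuple_of m (\<lambda>i. g *\<^sub>v v i) i"
  proof (cases "i < m")
    case True
    then have vi: "v i \<in> carrier_vec d" "v i \<noteq> 0\<^sub>v d" using v by (auto simp: nonzero_vecs_def)
    have "(\<lambda>u. g *\<^sub>v u) ` line (v i) = line (g *\<^sub>v v i)"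
    proof -
      have "(\<lambda>u. g *\<^sub>v u) ` line (v i) = {g *\<^sub>v (c \<cdot>\<^sub>v v i) | c. True}"
        unfolding line_def by blast
      then show ?thesis by (simp add: line_def mult_mat_vec[OF g vi(1)])
    qed
    moreover have "line (v i) \<in> proj_space d" using vi by (auto simp: proj_space_eq)
    ultimately show ?thesis using True by (simp add: tuple_of_def)
  qed (simp add: tuple_of_def)
qed

lemma mem_orbit_diagonal_PGL:
  assumes v: "nonzero_vecs d m v"
  shows "p \<in> orbit (diagonal_PGL d m) (tuple_of m v) \<longleftrightarrow>
    (\<exists>g. g \<in> carrier_mat d d \<and> invertible_mat g \<and> p = tuple_of m (\<lambda>i. g *\<^sub>v v i))"
proof
  assume "p \<in> orbit (diagonal_PGL d m) (tuple_of m v)"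
  then obtain \<gamma> where \<gamma>: "\<gamma> \<in> PGL d" "p = (\<lambda>i\<in>{..<m}. \<gamma> (tuple_of m v i))"
    unfolding orbit_def diagonal_PGL_def by blast
  then obtain g where g: "g \<in> carrier_mat d d" "invertible_mat g"
      "\<gamma> = restrict (\<lambda>L. (\<lambda>u. g *\<^sub>v u) ` L) (proj_space d)"
    unfolding PGL_def by blast
  have "p = tuple_of m (\<lambda>i. g *\<^sub>v v i)"
    unfolding \<gamma>(2) g(3) by (rule diagonal_action_tuple_of[OF g(1) v])
  with g show "\<exists>g. g \<in> carrier_mat d d \<and> invertible_mat g \<and> p = tuple_of m (\<lambda>i. g *\<^sub>v v i)" by blast
next
  assume "\<exists>g. g \<in> carrier_mat d d \<and> invertible_mat g \<and> p = tuple_of m (\<lambda>i. g *\<^sub>v v i)"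
  then obtain g where g: "g \<in> carrier_mat d d" "invertible_mat g" "p = tuple_of m (\<lambda>i. g *\<^sub>v v i)" by blast
  define \<gamma> where "\<gamma> = restrict (\<lambda>L. (\<lambda>u. g *\<^sub>v u) ` L) (proj_space d)"
  have "\<gamma> \<in> PGL d"
    unfolding PGL_def mem_Collect_eq \<gamma>_def using g(1,2) by (intro exI[of _ g] conjI refl)
  then have "(\<lambda>p. \<lambda>i\<in>{..<m}. \<gamma> (p i)) \<in> diagonal_PGL d m"
    unfolding diagonal_PGL_def mem_Collect_eq by (intro exI[of _ \<gamma>] conjI refl)
  moreover have "p = (\<lambda>i\<in>{..<m}. \<gamma> (tuple_of m v i))"
    unfolding g(3) \<gamma>_def by (rule diagonal_action_tuple_of[OF g(1) v, symmetric])
  ultimately show "p \<in> orbit (diagonal_PGL d m) (tuple_of m v)"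
    unfolding orbit_def mem_Collect_eq by (intro exI[of _ "\<lambda>p. \<lambda>i\<in>{..<m}. \<gamma> (p i)"] conjI)
qed

text \<open>The assumptions are symmetric in \<open>d\<close> and \<open>n\<close>. Through
  \<open>swap\<close>, every result is also available for the transform in the opposite
  direction.\<close>

locale gale_duality =
  fixes d n m :: nat
  assumes m_eq: "m = d + n" and d_pos: "0 < d" and n_pos: "0 < n" and coprime_d_m: "coprime d m"
begin

lemma m_pos: "0 < m" and d_less: "d < m" and n_less: "n < m"
  using m_eq d_pos n_pos by auto

lemma swap: "gale_duality n d m"
proof
  show "coprime n m" using coprime_d_m m_eq gcd_add2[of n d]
    by (simp add: coprime_iff_gcd_eq_1 gcd.commute add.commute)
qed (use m_eq d_pos n_pos in auto)

lemma config_basis: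
  assumes "config d m v"
  obtains J where "J \<subseteq> {..<m}" "basis_of d (coords v) J"
  using stable_tuple_basis[of d m "coords v"] assms d_pos d_less by (auto simp: config_def)

text \<open>Enumerations of a column basis of \<open>v\<close> and of its complement. The
  determinant condition is open, so the same enumerations serve for nearby tuples.\<close>

lemma gale_dual_chart:
  assumes "config d m v"
  obtains e e' where "inj_on e {..<d}" "e ` {..<d} \<subseteq> {..<m}"
    "bij_betw e' {..<n} ({..<m} - e ` {..<d})" "Determinant.det (basis_matrix d e v) \<noteq> 0"
proof -
  obtain J where J: "J \<subseteq> {..<m}" "basis_of d (coords v) J" by (rule config_basis[OF assms])
  have fin: "finite J" "card J = d" using J(2) by (auto simp: basis_of_def)
  obtain e where e: "bij_betw e {..<d} J"
    using ex_bij_betw_nat_finite[OF fin(1)] fin(2) by (auto simp: lessThan_atLeast0)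
  have eJ: "e ` {..<d} = J" "inj_on e {..<d}" using e by (auto simp: bij_betw_def)
  have "card ({..<m} - J) = n" using J(1) fin m_eq by (simp add: card_Diff_subset)
  then obtain e' where e': "bij_betw e' {..<n} ({..<m} - e ` {..<d})"
    using ex_bij_betw_nat_finite[of "{..<m} - J"] by (auto simp: lessThan_atLeast0 eJ(1)[unfolded lessThan_atLeast0])
  have "indep d (coords v) (e ` {..<d})" using J(2) eJ(1) by (simp add: basis_of_def)
  then have "Determinant.det (basis_matrix d e v) \<noteq> 0" by (rule det_basis_matrix[OF eJ(2)])
  then show ?thesis using that[OF eJ(2) _ e'] J(1) eJ(1) by simp
qed

lemma config_gale_dual:
  assumes v: "config d m v" and e: "inj_on e {..<d}" "e ` {..<d} \<subseteq> {..<m}"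
    and e': "bij_betw e' {..<n} ({..<m} - e ` {..<d})"
    and det: "Determinant.det (basis_matrix d e v) \<noteq> 0"
  shows "config n m (gale_dual d n e e' v)"
    and "gale_related d n m (tuple_of m v) (tuple_of m (gale_dual d n e e' v))"
proof -
  let ?w = "gale_dual d n e e' v"
  have g: "gale d n m (coords v) (coords ?w)" by (rule gale_dual_gale[OF m_eq e e'])
  have st: "stable_tuple n m (coords ?w)"
    by (rule gale_dual_stable[OF m_eq d_pos n_pos g _ gale_dual_basis[OF e' det]])
      (use v in \<open>auto simp: config_def\<close>)
  have "nonzero_vecs n m ?w"
    by (rule stable_imp_nonzero_vecs[OF st _ n_pos n_less]) (simp add: gale_dual_def)
  then show c: "config n m ?w" using st by (simp add: config_def)
  show "gale_related d n m (tuple_of m v) (tuple_of m ?w)"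
    using v c by (intro gale_imp_related g) (auto simp: config_def)
qed

lemma ex_gale_related:
  assumes "p \<in> semistable_tuples d m"
  shows "\<exists>q\<in>semistable_tuples n m. gale_related d n m p q"
proof -
  obtain v where v: "config d m v" "p = tuple_of m v"
    by (rule semistable_tuples_obtain[OF assms m_pos])
  obtain e e' where *: "inj_on e {..<d}" "e ` {..<d} \<subseteq> {..<m}"
    "bij_betw e' {..<n} ({..<m} - e ` {..<d})" "Determinant.det (basis_matrix d e v) \<noteq> 0"
    by (rule gale_dual_chart[OF v(1)])
  note w = config_gale_dual[OF v(1) *]
  have "tuple_of m (gale_dual d n e e' v) \<in> semistable_tuples n m"
    using w(1) tuple_of_in_semistable_tuples[of n m "gale_dual d n e e' v"] m_pos
    by (simp add: config_def)
  then show ?thesis using w(2) v(2) by blast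
qed

text \<open>Multiplication by \<open>g\<close> only changes generators of the row space of
  \<open>v\<close> and preserves orthogonality to \<open>w\<close>. Conversely, two matrices of full
  rank orthogonal to the same \<open>w\<close> differ by an invertible factor, by
  \<open>gale_unique\<close>.\<close>

lemma orbit_eq_gale_related:
  assumes p: "p \<in> semistable_tuples d m" and q: "q \<in> semistable_tuples n m"
    and pq: "gale_related d n m p q"
  shows "orbit (diagonal_PGL d m) p = {p' \<in> semistable_tuples d m. gale_related d n m p' q}"
proof -
  obtain v0 where v0: "config d m v0" "p = tuple_of m v0"
    by (rule semistable_tuples_obtain[OF p m_pos])
  obtain w where w: "config n m w" "q = tuple_of m w"
    by (rule semistable_tuples_obtain[OF q m_pos])
  have nz: "nonzero_vecs d m v0" "nonzero_vecs n m w" using v0 w by (auto simp: config_def)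
  obtain s where s: "\<forall>i. s i \<noteq> 0" "gale d n m (coords (\<lambda>i. s i \<cdot>\<^sub>v v0 i)) (coords w)"
    using pq gale_related_iff[OF nz] v0(2) w(2) by blast
  define v where "v = (\<lambda>i. s i \<cdot>\<^sub>v v0 i)"
  have v: "config d m v" "p = tuple_of m v" "gale d n m (coords v) (coords w)"
    using config_scale[OF v0(1) _ m_pos, of s] s tuple_of_scale[of m s v0] v0(2) by (auto simp: v_def)
  have nzv: "nonzero_vecs d m v" and carv: "\<And>i. i < m \<Longrightarrow> v i \<in> carrier_vec d"
    using v(1) by (auto simp: config_def nonzero_vecs_def)
  show ?thesis
  proof (intro equalityI subsetI)
    fix p' assume "p' \<in> orbit (diagonal_PGL d m) p"
    then obtain g where g: "g \<in> carrier_mat d d" "invertible_mat g" "p' = tuple_of m (\<lambda>i. g *\<^sub>v v i)"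
      unfolding v(2) mem_orbit_diagonal_PGL[OF nzv] by blast
    have c: "config d m (\<lambda>i. g *\<^sub>v v i)" by (rule config_matrix_mult[OF v(1) g(1,2) d_pos d_less])
    then have nzg: "nonzero_vecs d m (\<lambda>i. g *\<^sub>v v i)" by (simp add: config_def)
    have "gale d n m (coords (\<lambda>i. g *\<^sub>v v i)) (coords w)"
      unfolding gale_def
    proof (intro allI impI)
      fix a b assume ab: "a < d" "b < n"
      have "(\<Sum>i<m. (g *\<^sub>v v i) $ a * w i $ b) = (\<Sum>i<m. (\<Sum>k<d. g $$ (a, k) * v i $ k) * w i $ b)"
        by (intro sum.cong refl arg_cong2[of _ _ _ _ "(*)"] mult_mat_vec_index[OF g(1) carv ab(1)]) simp
      also have "\<dots> = 0"
        by (rule gale_functional[OF iffD1[OF gale_sym v(3)] ab(2)])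
      finally show "(\<Sum>i<m. (g *\<^sub>v v i) $ a * w i $ b) = 0" .
    qed
    then have "gale_related d n m p' q"
      unfolding g(3) w(2) by (rule gale_imp_related[OF nzg nz(2)])
    moreover have "p' \<in> semistable_tuples d m"
      using c tuple_of_in_semistable_tuples[OF nzg m_pos] g(3) by simp
    ultimately show "p' \<in> {p' \<in> semistable_tuples d m. gale_related d n m p' q}" by simp
  next
    fix p' assume "p' \<in> {p' \<in> semistable_tuples d m. gale_related d n m p' q}"
    then have p': "p' \<in> semistable_tuples d m" "gale_related d n m p' q" by auto
    obtain u0 where u0: "config d m u0" "p' = tuple_of m u0"
      by (rule semistable_tuples_obtain[OF p'(1) m_pos])
    have nzu0: "nonzero_vecs d m u0" using u0 by (simp add: config_def)
    obtain t where t: "\<forall>i. t i \<noteq> 0" "gale d n m (coords (\<lambda>i. t i \<cdot>\<^sub>v u0 i)) (coords w)"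
      using p'(2) gale_related_iff[OF nzu0 nz(2)] u0(2) w(2) by blast
    define u where "u = (\<lambda>i. t i \<cdot>\<^sub>v u0 i)"
    have u: "config d m u" "p' = tuple_of m u" "gale d n m (coords u) (coords w)"
      using config_scale[OF u0(1) _ m_pos, of t] t tuple_of_scale[of m t u0] u0(2) by (auto simp: u_def)
    have caru: "\<And>i. i < m \<Longrightarrow> u i \<in> carrier_vec d"
      using u(1) by (auto simp: config_def nonzero_vecs_def)
    obtain B where B: "B \<subseteq> {..<m}" "basis_of d (coords v) B" by (rule config_basis[OF v(1)])
    obtain B' where B': "B' \<subseteq> {..<m}" "basis_of d (coords u) B'" by (rule config_basis[OF u(1)])
    obtain K where K: "K \<subseteq> {..<m}" "basis_of n (coords w) K"
      by (rule gale_duality.config_basis[OF swap w(1)])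
    obtain h where h: "\<forall>i<m. \<forall>a<d. u i $ a = (\<Sum>b<d. h a b * v i $ b)"
        "\<forall>y. (\<forall>b<d. (\<Sum>a<d. y a * h a b) = 0) \<longrightarrow> (\<forall>a<d. y a = 0)"
      using gale_unique[OF m_eq v(3) u(3) B(2,1) B'(2,1) K(2,1)] by blast
    define g where "g = mat d d (\<lambda>(a, b). h a b)"
    have g: "g \<in> carrier_mat d d" by (simp add: g_def)
    \<comment> \<open>Trivial left kernel of \<open>h\<close> means trivial kernel of the transpose
      of \<open>g\<close>.\<close>
    have "Determinant.det g\<^sup>T \<noteq> 0"
    proof
      assume "Determinant.det g\<^sup>T = 0"
      then obtain y where y: "y \<in> carrier_vec d" "y \<noteq> 0\<^sub>v d" "g\<^sup>T *\<^sub>v y = 0\<^sub>v d"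
        using det_0_iff_vec_prod_zero[of "g\<^sup>T" d] g by auto
      have "(\<Sum>a<d. y $ a * h a b) = 0" if b: "b < d" for b
      proof -
        have "(\<Sum>a<d. y $ a * h a b) = (g\<^sup>T *\<^sub>v y) $ b"
          using b y(1) g by (subst mult_mat_vec_index[where n = d]) (auto simp: g_def mult.commute)
        then show ?thesis using y(3) b by simp
      qed
      then have "\<forall>a<d. y $ a = 0" using h(2)[rule_format, of "\<lambda>a. y $ a"] by blast
      then have "y = 0\<^sub>v d" using y(1) by (intro eq_vecI) auto
      with y(2) show False by contradiction
    qed
    then have det: "Determinant.det g \<noteq> 0" by (simp add: det_transpose[OF g])
    obtain g' where g': "g' * g = 1\<^sub>m d" "g * g' = 1\<^sub>m d" "g' \<in> carrier_mat d d"
    proof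
      let ?g' = "inverse (Determinant.det g) \<cdot>\<^sub>m adj_mat g"
      note a = adj_mat[OF g]
      show "?g' \<in> carrier_mat d d" using a(1) by simp
      show "?g' * g = 1\<^sub>m d"
        unfolding mult_smult_assoc_mat[OF a(1) g] a(3) using det by (intro eq_matI) auto
      show "g * ?g' = 1\<^sub>m d"
        unfolding mult_smult_distrib[OF g a(1)] a(2) using det by (intro eq_matI) auto
    qed
    then have inv: "invertible_mat g"
      using g unfolding invertible_mat_def inverts_mat_def by (auto intro!: exI[of _ g'])
    have "u i = g *\<^sub>v v i" if i: "i < m" for i
    proof (rule eq_vecI)
      fix a assume "a < dim_vec (g *\<^sub>v v i)"
      then have a: "a < d" using g by simp
      show "u i $ a = (g *\<^sub>v v i) $ a"
        unfolding mult_mat_vec_index[OF g carv[OF i] a] using h(1) i a by (simp add: g_def)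
    qed (use g caru[OF i] in simp)
    then have "tuple_of m u = tuple_of m (\<lambda>i. g *\<^sub>v v i)"
      unfolding tuple_of_def by (intro restrict_ext) simp
    then show "p' \<in> orbit (diagonal_PGL d m) p"
      unfolding v(2) mem_orbit_diagonal_PGL[OF nzv] u(2) using g inv by blast
  qed
qed

text \<open>A tuple lies in the orbit iff the linear system for the scaling factors has a solution
  without zero entries. By \<open>gale_weights\<close> any nonzero solution on the semistable locus
  is of this kind, so membership is a rank condition, and its failure is shown to be open.\<close>

lemma orbit_closed:
  assumes p: "p \<in> semistable_tuples d m"
  shows "closedin (subtopology (zariski d m) (semistable_tuples d m)) (orbit (diagonal_PGL d m) p)"
proof -
  let ?S = "semistable_tuples d m"
  obtain q where q: "q \<in> semistable_tuples n m" "gale_related d n m p q"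
    using ex_gale_related[OF p] by blast
  obtain w where w: "config n m w" "q = tuple_of m w"
    by (rule semistable_tuples_obtain[OF q(1) m_pos])
  have nzw: "nonzero_vecs n m w" using w by (simp add: config_def)
  have orb: "orbit (diagonal_PGL d m) p = {p' \<in> ?S. gale_related d n m p' q}"
    by (rule orbit_eq_gale_related[OF p q])
  define U where "U = {p' \<in> ?S. \<not> gale_related d n m p' q}"
  have "openin (subtopology (zariski d m) ?S) U"
  proof (rule openin_zariski_polyfun[OF semistable_tuples_subset])
    show "U \<subseteq> ?S" by (auto simp: U_def)
    fix v assume v: "nonzero_vecs d m v" "tuple_of m v \<in> U"
    \<comment> \<open>The system has \<open>d * n\<close> equations in \<open>m\<close> unknowns.
      Writing \<open>N u\<close> for its coefficient matrix, \<open>M u\<close> is the conjugate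
      transpose of \<open>N v\<close> times \<open>N u\<close>: it is square, its determinant is
      polynomial in \<open>u\<close> because \<open>v\<close> is fixed, and a solution of the system
      for \<open>u\<close> lies in its kernel.\<close>
    define M where "M = (\<lambda>u. mat m m (\<lambda>(i, j). \<Sum>a<d. \<Sum>b<n. cnj (v i $ a * w i $ b) * (u j $ a * w j $ b)))"
    have M: "M u \<in> carrier_mat m m" for u by (simp add: M_def)
    have Mx: "(M u *\<^sub>v x) $ i = (\<Sum>a<d. \<Sum>b<n. cnj (v i $ a * w i $ b) * (\<Sum>j<m. x $ j * (u j $ a * w j $ b)))"
      if "i < m" "x \<in> carrier_vec m" for u x i
    proof -
      have "(M u *\<^sub>v x) $ i = (\<Sum>j<m. \<Sum>a<d. \<Sum>b<n. cnj (v i $ a * w i $ b) * (x $ j * (u j $ a * w j $ b)))"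
        unfolding mult_mat_vec_index[OF M that(2,1)]
        using that by (simp add: M_def sum_distrib_left sum_distrib_right mult_ac)
      also have "\<dots> = (\<Sum>a<d. \<Sum>b<n. \<Sum>j<m. cnj (v i $ a * w i $ b) * (x $ j * (u j $ a * w j $ b)))"
        by (subst sum.swap, rule sum.cong[OF refl], rule sum.swap)
      finally show ?thesis by (simp only: sum_distrib_left)
    qed
    have poly: "polyfun d m (\<lambda>u. Determinant.det (M u))"
      unfolding M_def
      by (intro polyfun_det polyfun_sum polyfun_mult polyfun_const polyfun_coord) auto
    have "Determinant.det (M v) \<noteq> 0"
    proof
      assume "Determinant.det (M v) = 0"
      then obtain x where x: "x \<in> carrier_vec m" "x \<noteq> 0\<^sub>v m" "M v *\<^sub>v x = 0\<^sub>v m"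
        using det_0_iff_vec_prod_zero[OF M] by blast
      define r where "r = (\<lambda>a b. \<Sum>j<m. x $ j * (v j $ a * w j $ b))"
      \<comment> \<open>For \<open>u = v\<close> the matrix is a Gram matrix, so \<open>M v\<close>
        and the system itself have the same kernel: the form at \<open>x\<close> is the sum of the
        squared norms of the residues \<open>r a b\<close>.\<close>
      have "0 = (\<Sum>i<m. cnj (x $ i) * (M v *\<^sub>v x) $ i)" using x(3) by simp
      also have "\<dots> = (\<Sum>i<m. \<Sum>a<d. \<Sum>b<n. cnj (x $ i * (v i $ a * w i $ b)) * r a b)"
        using x(1) by (simp add: Mx r_def sum_distrib_left mult.assoc)
      also have "\<dots> = (\<Sum>a<d. \<Sum>b<n. \<Sum>i<m. cnj (x $ i * (v i $ a * w i $ b)) * r a b)"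
        by (subst sum.swap, rule sum.cong[OF refl], rule sum.swap)
      also have "\<dots> = (\<Sum>a<d. \<Sum>b<n. cnj (r a b) * r a b)"
        by (simp only: sum_distrib_right[symmetric] cnj_sum[symmetric] r_def)
      also have "\<dots> = of_real (\<Sum>a<d. \<Sum>b<n. (cmod (r a b))\<^sup>2)"
        unfolding of_real_sum complex_norm_square by (simp only: mult.commute)
      finally have "(\<Sum>a<d. \<Sum>b<n. (cmod (r a b))\<^sup>2) = 0" by (metis of_real_eq_0_iff)
      then have "\<forall>a\<in>{..<d}. (\<Sum>b<n. (cmod (r a b))\<^sup>2) = 0"
        by (subst (asm) sum_nonneg_eq_0_iff) (auto intro: sum_nonneg)
      then have r0: "r a b = 0" if "a < d" "b < n" for a b
        using that by (subst (asm) sum_nonneg_eq_0_iff) auto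
      have "\<exists>j<m. x $ j \<noteq> 0"
      proof (rule ccontr)
        assume "\<not> (\<exists>j<m. x $ j \<noteq> 0)"
        then have "x = 0\<^sub>v m" using x(1) by (intro eq_vecI) auto
        with x(2) show False by contradiction
      qed
      moreover have cv: "config d m v"
        using v tuple_of_in_semistable_tuples[OF v(1) m_pos] by (simp add: U_def)
      ultimately have xnz: "\<forall>j<m. x $ j \<noteq> 0"
        using gale_weights[OF m_eq d_pos n_pos coprime_d_m, of "coords v" "coords w" "\<lambda>j. x $ j"] w(1) r0
        by (simp add: config_def r_def)
      \<comment> \<open>The value 1 beyond the range makes the scaling nonzero at every
        index.\<close>
      define t where "t = (\<lambda>j. if j < m then x $ j else 1)"
      have "(\<Sum>j<m. t j * (v j $ a * w j $ b)) = r a b" for a b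
        unfolding r_def t_def by (intro sum.cong) auto
      then have "gale d n m (coords (\<lambda>i. t i \<cdot>\<^sub>v v i)) (coords w)"
        using v(1) r0 by (subst gale_scale_left) (auto simp: nonzero_vecs_def)
      moreover have "\<forall>i. t i \<noteq> 0" using xnz by (simp add: t_def)
      ultimately have "gale_related d n m (tuple_of m v) q"
        unfolding w(2) gale_related_iff[OF v(1) nzw] by blast
      with v(2) show False by (simp add: U_def)
    qed
    moreover have "tuple_of m u \<in> U"
      if u: "nonzero_vecs d m u" "tuple_of m u \<in> ?S" "Determinant.det (M u) \<noteq> 0" for u
    proof (rule ccontr)
      assume "tuple_of m u \<notin> U"
      then have "gale_related d n m (tuple_of m u) (tuple_of m w)" using u(2) w(2) by (simp add: U_def)
      then obtain t where t: "\<forall>i. t i \<noteq> 0" "gale d n m (coords (\<lambda>i. t i \<cdot>\<^sub>v u i)) (coords w)"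
        unfolding gale_related_iff[OF u(1) nzw] by blast
      have t0: "(\<Sum>j<m. t j * (u j $ a * w j $ b)) = 0" if "a < d" "b < n" for a b
        using t(2) gale_scale_left[of m u d n t w] u(1) that by (simp add: nonzero_vecs_def)
      define x where "x = vec m t"
      have x: "x \<in> carrier_vec m" "x \<noteq> 0\<^sub>v m"
        using t(1) m_pos by (auto simp: x_def vec_eq_iff)
      have "M u *\<^sub>v x = 0\<^sub>v m"
      proof (rule eq_vecI)
        fix i assume "i < dim_vec (0\<^sub>v m :: complex vec)"
        then have i: "i < m" by simp
        have "(\<Sum>j<m. x $ j * (u j $ a * w j $ b)) = 0" if "a < d" "b < n" for a b
          using t0[OF that] by (simp add: x_def)
        then show "(M u *\<^sub>v x) $ i = 0\<^sub>v m $ i" using i by (simp add: Mx[OF i x(1)])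
      qed (simp add: M_def)
      then have "Determinant.det (M u) = 0" using det_0_iff_vec_prod_zero[OF M] x by blast
      with u(3) show False by contradiction
    qed
    ultimately show "\<exists>Q. polyfun d m Q \<and> Q v \<noteq> 0 \<and>
        (\<forall>v'. nonzero_vecs d m v' \<longrightarrow> tuple_of m v' \<in> ?S \<longrightarrow> Q v' \<noteq> 0 \<longrightarrow> tuple_of m v' \<in> U)"
      using poly by (intro exI[of _ "\<lambda>u. Determinant.det (M u)"]) blast
  qed
  moreover have "topspace (subtopology (zariski d m) ?S) = ?S"
    using semistable_tuples_subset by (auto simp: topspace_zariski)
  moreover have "?S - orbit (diagonal_PGL d m) p = U" "orbit (diagonal_PGL d m) p \<subseteq> ?S"
    by (auto simp: orb U_def)
  ultimately show ?thesis by (simp add: closedin_def)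
qed

end


section \<open>The Gale transform on moduli spaces\<close>

lemma points_semistable_locus: "points (semistable_locus d m) = semistable_tuples d m"
  using semistable_tuples_subset
  by (auto simp: semistable_locus_def open_subspace_def proj_power_def topspace_zariski
      semistable_tuples_def)

lemma top_of_semistable_locus:
  "top_of (semistable_locus d m) = subtopology (zariski d m) (semistable_tuples d m)"
  by (simp add: semistable_locus_def open_subspace_def proj_power_def semistable_tuples_def)

lemma regular_semistable_locus: "regular (semistable_locus d m) = regular_on d m"
  by (simp add: semistable_locus_def open_subspace_def proj_power_def)

text \<open>Collecting all tuples related to some member of the orbit avoids a choice of
  representative; that the result is a single orbit is shown in
  \<open>gale_map_orbit\<close>.\<close>

definition gale_map :: "nat \<Rightarrow> nat \<Rightarrow> nat \<Rightarrow> point_tuple set \<Rightarrow> point_tuple set" where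
  "gale_map d n m Z = {q \<in> semistable_tuples n m. \<exists>p\<in>Z. gale_related d n m p q}"

context gale_duality
begin

abbreviation orb :: "point_tuple \<Rightarrow> point_tuple set" where
  "orb \<equiv> orbit (diagonal_PGL d m)"

section \<open>Orbits as the points of the quotient\<close>

lemma orbit_self: "p \<in> semistable_tuples d m \<Longrightarrow> p \<in> orb p"
  using ex_gale_related[of p] orbit_eq_gale_related[of p] by blast

lemma orbit_eqI:
  assumes p: "p \<in> semistable_tuples d m" and p': "p' \<in> orb p"
  shows "orb p' = orb p"
proof -
  obtain q where q: "q \<in> semistable_tuples n m" "gale_related d n m p q"
    using ex_gale_related[OF p] by blast
  note eq = orbit_eq_gale_related[OF p q]
  then have "p' \<in> semistable_tuples d m" "gale_related d n m p' q" using p' by auto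
  then show ?thesis using orbit_eq_gale_related[of p' q] q(1) eq by simp
qed

lemma closed_orbits_eq:
  "closed_orbits (semistable_locus d m) (diagonal_PGL d m) = orb ` semistable_tuples d m"
  unfolding closed_orbits_def points_semistable_locus unfolding top_of_semistable_locus
  by (auto simp: orbit_closed)

text \<open>All orbits are closed, and orbits that meet coincide, so the unique closed orbit in the
  closure of \<open>orb p\<close> is \<open>orb p\<close> itself.\<close>

lemma quotient_proj_eq:
  assumes p: "p \<in> semistable_tuples d m"
  shows "quotient_proj (semistable_locus d m) (diagonal_PGL d m) p = orb p"
  unfolding quotient_proj_def closed_orbits_eq top_of_semistable_locus closure_of_closedin[OF orbit_closed[OF p]]
proof (rule the_equality)
  show "orb p \<in> orb ` semistable_tuples d m \<and> orb p \<subseteq> orb p" using p by blast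
  fix Z assume Z: "Z \<in> orb ` semistable_tuples d m \<and> Z \<subseteq> orb p"
  then obtain p' where p': "p' \<in> semistable_tuples d m" "Z = orb p'" by blast
  then have "p' \<in> orb p" using Z orbit_self[OF p'(1)] by blast
  then show "Z = orb p" using orbit_eqI[OF p] p'(2) by simp
qed

lemma quotient_preimage_eq:
  "quotient_preimage (semistable_locus d m) (diagonal_PGL d m) U = {p \<in> semistable_tuples d m. orb p \<in> U}"
  unfolding quotient_preimage_def points_semistable_locus by (auto simp: quotient_proj_eq)

lemma openin_moduli_space:
  "openin (top_of (moduli_space d m)) U \<longleftrightarrow> U \<subseteq> orb ` semistable_tuples d m \<and>
    openin (subtopology (zariski d m) (semistable_tuples d m)) {p \<in> semistable_tuples d m. orb p \<in> U}"
  unfolding moduli_space_def openin_GIT_quotient closed_orbits_eq quotient_preimage_eq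
    top_of_semistable_locus ..

lemma points_moduli_space: "points (moduli_space d m) = orb ` semistable_tuples d m"
proof
  show "points (moduli_space d m) \<subseteq> orb ` semistable_tuples d m"
    using openin_moduli_space[of "points (moduli_space d m)"] openin_topspace by blast
  have "{p \<in> semistable_tuples d m. orb p \<in> orb ` semistable_tuples d m} = semistable_tuples d m"
    by blast
  moreover have "openin (subtopology (zariski d m) (semistable_tuples d m)) (semistable_tuples d m)"
    using openin_topspace[of "subtopology (zariski d m) (semistable_tuples d m)"]
      semistable_tuples_subset[of d m] by (simp add: topspace_zariski inf_absorb2)
  ultimately have "openin (top_of (moduli_space d m)) (orb ` semistable_tuples d m)"
    by (simp add: openin_moduli_space)
  then show "orb ` semistable_tuples d m \<subseteq> points (moduli_space d m)" by (rule openin_subset)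
qed

lemma regular_moduli_space:
  "f \<in> regular (moduli_space d m) U \<longleftrightarrow>
    f \<circ> quotient_proj (semistable_locus d m) (diagonal_PGL d m) \<in> regular_on d m {p \<in> semistable_tuples d m. orb p \<in> U}"
  by (simp add: moduli_space_def GIT_quotient_def regular_semistable_locus quotient_preimage_eq)

section \<open>The transform between the quotients\<close>

lemma gale_map_orbit:
  assumes p: "p \<in> semistable_tuples d m" and q: "q \<in> semistable_tuples n m" and pq: "gale_related d n m p q"
  shows "gale_map d n m (orb p) = orbit (diagonal_PGL n m) q"
proof (intro equalityI subsetI)
  note dual = gale_duality.orbit_eq_gale_related[OF swap]
  fix q' assume "q' \<in> gale_map d n m (orb p)"
  then obtain p' where q': "q' \<in> semistable_tuples n m" "p' \<in> orb p" "gale_related d n m p' q'"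
    by (auto simp: gale_map_def)
  then have p': "p' \<in> semistable_tuples d m" "gale_related d n m p' q"
    using orbit_eq_gale_related[OF p q pq] by auto
  \<comment> \<open>Both \<open>q\<close> and \<open>q'\<close> are related to \<open>p'\<close>,
    and by the dual description of orbits the tuples related to \<open>p'\<close> form the orbit of
    \<open>q\<close>.\<close>
  then show "q' \<in> orbit (diagonal_PGL n m) q"
    using dual[OF q p'(1)] q'(1,3) by (simp add: gale_related_sym[of n d])
next
  fix q' assume "q' \<in> orbit (diagonal_PGL n m) q"
  then have "q' \<in> semistable_tuples n m" "gale_related d n m p q'"
    using gale_duality.orbit_eq_gale_related[OF swap q p] pq by (auto simp: gale_related_sym[of n d])
  then show "q' \<in> gale_map d n m (orb p)" using orbit_self[OF p] by (auto simp: gale_map_def)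
qed

lemma gale_map_inverse:
  assumes "Z \<in> orb ` semistable_tuples d m"
  shows "gale_map n d m (gale_map d n m Z) = Z"
proof -
  obtain p where p: "p \<in> semistable_tuples d m" "Z = orb p" using assms by blast
  obtain q where q: "q \<in> semistable_tuples n m" "gale_related d n m p q"
    using ex_gale_related[OF p(1)] by blast
  have "gale_map d n m Z = orbit (diagonal_PGL n m) q"
    unfolding p(2) by (rule gale_map_orbit[OF p(1) q])
  moreover have "gale_map n d m (orbit (diagonal_PGL n m) q) = orb p"
    by (rule gale_duality.gale_map_orbit[OF swap q(1) p(1)]) (use q(2) gale_related_sym in blast)
  ultimately show ?thesis using p(2) by simp
qed

lemma gale_map_chart:
  assumes v: "config d m v"
  obtains b \<delta> where "\<And>i j. j < n \<Longrightarrow> polyfun d m (\<lambda>v. b v i $ j)" "polyfun d m \<delta>" "\<delta> v \<noteq> 0"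
    "\<And>v'. config d m v' \<Longrightarrow> \<delta> v' \<noteq> 0 \<Longrightarrow> config n m (b v') \<and>
      gale_map d n m (orb (tuple_of m v')) = orbit (diagonal_PGL n m) (tuple_of m (b v'))"
proof -
  obtain e e' where e: "inj_on e {..<d}" "e ` {..<d} \<subseteq> {..<m}"
    "bij_betw e' {..<n} ({..<m} - e ` {..<d})" "Determinant.det (basis_matrix d e v) \<noteq> 0"
    by (rule gale_dual_chart[OF v])
  have e': "e' ` {..<n} \<subseteq> {..<m}" using e(3) by (auto simp: bij_betw_def)
  have "config n m (gale_dual d n e e' v') \<and>
      gale_map d n m (orb (tuple_of m v')) = orbit (diagonal_PGL n m) (tuple_of m (gale_dual d n e e' v'))"
    if v': "config d m v'" "Determinant.det (basis_matrix d e v') \<noteq> 0" for v'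
  proof -
    note w = config_gale_dual[OF v'(1) e(1-3) v'(2)]
    have "tuple_of m v' \<in> semistable_tuples d m" "tuple_of m (gale_dual d n e e' v') \<in> semistable_tuples n m"
      using v'(1) w(1) m_pos by (simp_all add: config_def tuple_of_in_semistable_tuples)
    then show ?thesis using gale_map_orbit w by blast
  qed
  then show ?thesis
    using that[of "gale_dual d n e e'" "\<lambda>v. Determinant.det (basis_matrix d e v)"]
      polyfun_gale_dual[OF e(2) e'] polyfun_det_basis_matrix[OF e(2)] e(4) by blast
qed

text \<open>Multihomogeneous conditions on the target pull back along the local lift to polynomial
  conditions on the source. They need not be multihomogeneous, which is why
  \<open>openin_zariski_polyfun\<close> and \<open>regular_on_polyfun\<close> allow arbitrary
  polynomials.\<close>

lemma morphism_gale_map: "morphism (moduli_space d m) (moduli_space n m) (gale_map d n m)"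
proof -
  interpret dual: gale_duality n d m by (rule swap)
  let ?S = "semistable_tuples d m" and ?S' = "semistable_tuples n m"
  have maps: "gale_map d n m (orb p) \<in> dual.orb ` ?S'" if "p \<in> ?S" for p
    using ex_gale_related[OF that] gale_map_orbit[OF that] by blast
  have tS: "tuple_of m v \<in> ?S \<longleftrightarrow> config d m v" if "nonzero_vecs d m v" for v
    by (rule tuple_of_in_semistable_tuples[OF that m_pos])
  have tS': "tuple_of m w \<in> ?S'" and nz': "nonzero_vecs n m w" if "config n m w" for w
    using that tuple_of_in_semistable_tuples[of n m w] m_pos by (auto simp: config_def)
  have preimage: "{p \<in> ?S. orb p \<in> {Z \<in> orb ` ?S. gale_map d n m Z \<in> U}} =
      {p \<in> ?S. gale_map d n m (orb p) \<in> U}" for U by blast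
  have "openin (top_of (moduli_space d m)) {Z \<in> orb ` ?S. gale_map d n m Z \<in> U}"
    if U: "openin (top_of (moduli_space n m)) U" for U
    unfolding openin_moduli_space preimage
  proof
    obtain T where T: "openin (zariski n m) T" "{q \<in> ?S'. dual.orb q \<in> U} = T \<inter> ?S'"
      using U unfolding dual.openin_moduli_space openin_subtopology by blast
    show "openin (subtopology (zariski d m) ?S) {p \<in> ?S. gale_map d n m (orb p) \<in> U}"
    proof (rule openin_zariski_polyfun[OF semistable_tuples_subset])
      fix v assume v: "nonzero_vecs d m v" "tuple_of m v \<in> {p \<in> ?S. gale_map d n m (orb p) \<in> U}"
      have "config d m v" using tS[OF v(1)] v(2) by simp
      then obtain b \<delta> where b: "\<And>i j. j < n \<Longrightarrow> polyfun d m (\<lambda>v. b v i $ j)" "polyfun d m \<delta>" "\<delta> v \<noteq> 0"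
        "\<And>v'. config d m v' \<Longrightarrow> \<delta> v' \<noteq> 0 \<Longrightarrow> config n m (b v') \<and>
          gale_map d n m (orb (tuple_of m v')) = dual.orb (tuple_of m (b v'))"
        using gale_map_chart by blast
      have w: "config n m (b v)" "dual.orb (tuple_of m (b v)) \<in> U"
        using b(4)[of v] b(3) \<open>config d m v\<close> v(2) by auto
      then have "tuple_of m (b v) \<in> T" using T(2) tS'[OF w(1)] by blast
      then obtain k F where F: "multihom n m k F" "F (b v) \<noteq> 0" "nonvanishing n m F \<subseteq> T"
        using zariski_neighbourhood[OF T(1) nz'[OF w(1)]] by blast
      \<comment> \<open>The factor \<open>\<delta>\<close> restricts to tuples where the lift
        \<open>b\<close> represents the map, and \<open>F\<close> then places the image in
        \<open>T\<close>.\<close>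
      have "tuple_of m v' \<in> {p \<in> ?S. gale_map d n m (orb p) \<in> U}"
        if v': "nonzero_vecs d m v'" "tuple_of m v' \<in> ?S" "F (b v') * \<delta> v' \<noteq> 0" for v'
      proof -
        have c: "config n m (b v')" "gale_map d n m (orb (tuple_of m v')) = dual.orb (tuple_of m (b v'))"
          using b(4)[of v'] tS[OF v'(1)] v'(2,3) by auto
        have "tuple_of m (b v') \<in> T"
          using tuple_of_in_nonvanishing[OF F(1) nz'[OF c(1)]] F(3) v'(3) by auto
        then have "dual.orb (tuple_of m (b v')) \<in> U" using T(2) tS'[OF c(1)] by blast
        then show ?thesis using c(2) v'(2) by simp
      qed
      moreover have "polyfun d m (\<lambda>v. F (b v) * \<delta> v)"
        by (intro polyfun_mult polyfun_compose_multihom[OF F(1)] b)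
      ultimately show "\<exists>Q. polyfun d m Q \<and> Q v \<noteq> 0 \<and> (\<forall>v'. nonzero_vecs d m v' \<longrightarrow> tuple_of m v' \<in> ?S \<longrightarrow>
          Q v' \<noteq> 0 \<longrightarrow> tuple_of m v' \<in> {p \<in> ?S. gale_map d n m (orb p) \<in> U})"
        using F(2) b(3) by (intro exI[of _ "\<lambda>v. F (b v) * \<delta> v"]) simp
    qed auto
  qed auto
  then have cont: "continuous_map (top_of (moduli_space d m)) (top_of (moduli_space n m)) (gale_map d n m)"
    unfolding continuous_map_def points_moduli_space dual.points_moduli_space using maps by blast
  have "f \<circ> gale_map d n m \<in> regular (moduli_space d m) {Z \<in> orb ` ?S. gale_map d n m Z \<in> U}"
    if f: "f \<in> regular (moduli_space n m) U" for U f
    unfolding regular_moduli_space preimage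
  proof (rule regular_on_polyfun)
    let ?W = "{p \<in> ?S. gale_map d n m (orb p) \<in> U}" and ?U = "{q \<in> ?S'. dual.orb q \<in> U}"
    let ?f = "f \<circ> quotient_proj (semistable_locus n m) (diagonal_PGL n m)"
    let ?h = "f \<circ> gale_map d n m \<circ> quotient_proj (semistable_locus d m) (diagonal_PGL d m)"
    have f': "?f \<in> regular_on n m ?U" using f by (simp add: dual.regular_moduli_space)
    show "?W \<subseteq> proj_tuples d m" using semistable_tuples_subset by blast
    fix v assume v: "nonzero_vecs d m v" "tuple_of m v \<in> ?W"
    have "config d m v" using tS[OF v(1)] v(2) by simp
    then obtain b \<delta> where b: "\<And>i j. j < n \<Longrightarrow> polyfun d m (\<lambda>v. b v i $ j)" "polyfun d m \<delta>" "\<delta> v \<noteq> 0"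
      "\<And>v'. config d m v' \<Longrightarrow> \<delta> v' \<noteq> 0 \<Longrightarrow> config n m (b v') \<and>
        gale_map d n m (orb (tuple_of m v')) = dual.orb (tuple_of m (b v'))"
      using gale_map_chart by blast
    have c: "config n m (b v')" "tuple_of m (b v') \<in> ?U" "?h (tuple_of m v') = ?f (tuple_of m (b v'))"
      if v': "nonzero_vecs d m v'" "tuple_of m v' \<in> ?W" "\<delta> v' \<noteq> 0" for v'
    proof -
      have S: "tuple_of m v' \<in> ?S" using v'(2) by simp
      have *: "config n m (b v')" "gale_map d n m (orb (tuple_of m v')) = dual.orb (tuple_of m (b v'))"
        using b(4)[of v'] tS[OF v'(1)] S v'(3) by auto
      then show "config n m (b v')" "tuple_of m (b v') \<in> ?U" using tS'[OF *(1)] v'(2) by auto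
      show "?h (tuple_of m v') = ?f (tuple_of m (b v'))"
        using quotient_proj_eq[OF S] dual.quotient_proj_eq[OF tS'[OF *(1)]] *(2) by simp
    qed
    note c0 = c[OF v b(3)]
    obtain k F G l H where FGH: "multihom n m k F" "multihom n m k G" "multihom n m l H"
      "H (b v) \<noteq> 0" "G (b v) \<noteq> 0"
      "\<And>w. nonzero_vecs n m w \<Longrightarrow> tuple_of m w \<in> ?U \<Longrightarrow> H w \<noteq> 0 \<Longrightarrow>
        G w \<noteq> 0 \<and> ?f (tuple_of m w) = F w / G w"
      by (rule regular_onD[OF f' nz'[OF c0(1)] c0(2)], rule that)
    have eq: "?h (tuple_of m v') * (G (b v') * H (b v') * \<delta> v') = F (b v') * H (b v') * \<delta> v'"
      if v': "nonzero_vecs d m v'" "tuple_of m v' \<in> ?W" for v'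
    proof (cases "H (b v') = 0 \<or> \<delta> v' = 0")
      case True
      then show ?thesis by auto
    next
      case False
      then have \<delta>: "\<delta> v' \<noteq> 0" by simp
      note c' = c[OF v' \<delta>]
      have "G (b v') \<noteq> 0 \<and> ?f (tuple_of m (b v')) = F (b v') / G (b v')"
        using FGH(6)[OF nz'[OF c'(1)] c'(2)] False by blast
      then show ?thesis unfolding c'(3) by simp
    qed
    have poly: "polyfun d m (\<lambda>v. G (b v) * H (b v) * \<delta> v)" "polyfun d m (\<lambda>v. F (b v) * H (b v) * \<delta> v)"
      by (intro polyfun_mult b polyfun_compose_multihom[OF FGH(1)] polyfun_compose_multihom[OF FGH(2)]
          polyfun_compose_multihom[OF FGH(3)]; assumption)+
    show "\<exists>P Q. polyfun d m P \<and> polyfun d m Q \<and> Q v \<noteq> 0 \<and>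
        (\<forall>v'. nonzero_vecs d m v' \<longrightarrow> tuple_of m v' \<in> ?W \<longrightarrow> ?h (tuple_of m v') * Q v' = P v')"
    proof (rule exI[of _ "\<lambda>v. F (b v) * H (b v) * \<delta> v"], rule exI[of _ "\<lambda>v. G (b v) * H (b v) * \<delta> v"],
        intro conjI allI impI)
      show "G (b v) * H (b v) * \<delta> v \<noteq> 0" using FGH(4,5) b(3) by simp
    qed (fact poly eq)+
  qed
  then show ?thesis unfolding morphism_def points_moduli_space using cont by blast
qed

end

theorem theorem3p1:
  fixes d m :: nat
  assumes "d > 0" and "m > 0" and "coprime d m" and "d < m"
  shows "isomorphic (moduli_space d m) (moduli_space (m - d) m)"
proof -
  interpret gale_duality d "m - d" m by standard (use assms in auto)
  interpret dual: gale_duality "m - d" d m by (rule swap)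
  show ?thesis
    unfolding isomorphic_def
  proof (intro exI conjI ballI)
    show "morphism (moduli_space d m) (moduli_space (m - d) m) (gale_map d (m - d) m)"
      by (rule morphism_gale_map)
    show "morphism (moduli_space (m - d) m) (moduli_space d m) (gale_map (m - d) d m)"
      by (rule dual.morphism_gale_map)
    show "gale_map (m - d) d m (gale_map d (m - d) m Z) = Z" if "Z \<in> points (moduli_space d m)" for Z
      using that by (intro gale_map_inverse) (simp add: points_moduli_space)
    show "gale_map d (m - d) m (gale_map (m - d) d m Z) = Z" if "Z \<in> points (moduli_space (m - d) m)" for Z
      using that by (intro dual.gale_map_inverse) (simp add: dual.points_moduli_space)
  qed
qed

end
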